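(* Let $n\ge2$, let $\mathfrak g=\{Z\in \mathrm{Mat}_{2n+1}(\mathbb C): Zq+qZ^T=0\}\cong\mathfrak{so}(2n+1,\mathbb C)$, where $q$ is the anti-diagonal matrix with all anti-diagonal entries equal to $1$, and let $$\Lambda_1=\begin{pmatrix}0&0&1\\0&-\mathrm{Id}_{2n-1}&0\\1&0&0\end{pmatrix}.$$ Let $\mathfrak g=\mathfrak g_0\oplus\mathfrak g_1$ be the decomposition into the $+1$ and $-1$ eigenspaces of the involution $Z\mapsto\Lambda_1Z\Lambda_1^{-1}$. Let $\tilde{\mathfrak g}_0\subset\mathfrak g$ be the subalgebra of matrices whose first and last rows and columns vanish, and let $V\subset\mathfrak g_0$ be the subspace of matrices whose central $(2n-1)\times(2n-1)$ block vanishes. Then $\mathfrak g_0=\tilde{\mathfrak g}_0\oplus V$, $\tilde{\mathfrak g}_0\cong\mathfrak{so}(2n-1,\mathbb C)$ (type $B_{n-1}$), $V$ is the vector representation of $\tilde{\mathfrak g}_0$, $\mathfrak g_0\cong\mathfrak{so}(2n,\mathbb C)$, and $$\dim\tilde{\mathfrak g}_0=(n-1)(2n-1),\qquad \dim V=2n-1,\qquad \dim\mathfrak g_1=2n.$$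
   Context: The block decomposition of $\Lambda_1$ is by sizes $1,2n-1,1$. The subalgebra $\tilde{\mathfrak g}_0$ acts on $V$ by the commutator; the vector representation of $\mathfrak{so}(2n-1,\mathbb C)$ is its standard $(2n-1)$-dimensional representation. *)

theory Defs
  imports
    Complex_Main
    "Jordan_Normal_Form.VS_Connect"
    "Jordan_Normal_Form.Gauss_Jordan_Elimination"
begin

section \<open>Subspaces and Lie algebras of complex square matrices\<close>

abbreviation mat_space :: "nat \<Rightarrow> (complex, complex mat) module" where
  "mat_space N \<equiv> module_mat TYPE(complex) N N"

abbreviation mat_subspace :: "nat \<Rightarrow> complex mat set \<Rightarrow> bool" where
  "mat_subspace N S \<equiv> VectorSpace.subspace class_ring S (mat_space N)"

abbreviation mat_vs :: "nat \<Rightarrow> complex mat set \<Rightarrow> (complex, complex mat) module" where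
  "mat_vs N S \<equiv> (mat_space N)\<lparr>carrier := S\<rparr>"

text \<open>The library's \<open>dim\<close> is the least size of a finite generating set, which is unspecified
  unless the space is finite-dimensional, hence the conjunct \<open>fin_dim\<close>.\<close>

definition has_dim :: "nat \<Rightarrow> complex mat set \<Rightarrow> nat \<Rightarrow> bool" where
  "has_dim N S d \<longleftrightarrow>
     mat_subspace N S \<and>
     vectorspace.fin_dim class_ring (mat_vs N S) \<and>
     vectorspace.dim class_ring (mat_vs N S) = d"

definition internal_direct_sum ::
    "nat \<Rightarrow> complex mat set \<Rightarrow> complex mat set \<Rightarrow> complex mat set \<Rightarrow> bool" where
  "internal_direct_sum N S A B \<longleftrightarrow>
     mat_subspace N S \<and> mat_subspace N A \<and> mat_subspace N B \<and>
     S = module.submodule_sum (mat_space N) A B \<and>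
     A \<inter> B = {0\<^sub>m N N}"

definition lie_bracket :: "complex mat \<Rightarrow> complex mat \<Rightarrow> complex mat" where
  "lie_bracket X Y = X * Y - Y * X"

definition mat_lie_algebra :: "nat \<Rightarrow> complex mat set \<Rightarrow> bool" where
  "mat_lie_algebra N L \<longleftrightarrow>
     mat_subspace N L \<and> (\<forall>X\<in>L. \<forall>Y\<in>L. lie_bracket X Y \<in> L)"

definition lie_isomorphism ::
    "nat \<Rightarrow> complex mat set \<Rightarrow> nat \<Rightarrow> complex mat set \<Rightarrow> (complex mat \<Rightarrow> complex mat) \<Rightarrow> bool" where
  "lie_isomorphism N L M L' \<phi> \<longleftrightarrow>
     mat_lie_algebra N L \<and> mat_lie_algebra M L' \<and>
     linear_map class_ring (mat_vs N L) (mat_vs M L') \<phi> \<and>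
     bij_betw \<phi> L L' \<and>
     (\<forall>X\<in>L. \<forall>Y\<in>L. \<phi> (lie_bracket X Y) = lie_bracket (\<phi> X) (\<phi> Y))"

definition lie_isomorphic ::
    "nat \<Rightarrow> complex mat set \<Rightarrow> nat \<Rightarrow> complex mat set \<Rightarrow> bool" where
  "lie_isomorphic N L M L' \<longleftrightarrow> (\<exists>\<phi>. lie_isomorphism N L M L' \<phi>)"

definition so_alg :: "nat \<Rightarrow> complex mat set" where
  "so_alg m = {X \<in> carrier_mat m m. transpose_mat X = - X}"

text \<open>\<open>B\<^sub>l\<close> names the classical series \<open>so(2l + 1, \<complex>)\<close>.\<close>

definition lie_type_B :: "nat \<Rightarrow> nat \<Rightarrow> complex mat set \<Rightarrow> bool" where
  "lie_type_B l N L \<longleftrightarrow> lie_isomorphic N L (2 * l + 1) (so_alg (2 * l + 1))"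

text \<open>\<open>V\<close> is the vector representation of \<open>L\<close> (\<open>\<cong> so(m, \<complex>)\<close>) under the commutator: after
  identifying \<open>L\<close> with \<open>so(m, \<complex>)\<close>, it is isomorphic to \<open>\<complex>\<^sup>m\<close> with matrices acting on vectors.\<close>

definition is_vector_representation ::
    "nat \<Rightarrow> nat \<Rightarrow> complex mat set \<Rightarrow> complex mat set \<Rightarrow> bool" where
  "is_vector_representation m N L V \<longleftrightarrow>
     mat_subspace N V \<and>
     (\<forall>X\<in>L. \<forall>v\<in>V. lie_bracket X v \<in> V) \<and>
     (\<exists>\<phi> \<psi>. lie_isomorphism N L m (so_alg m) \<phi> \<and>
        linear_map class_ring (mat_vs N V) (module_vec TYPE(complex) m) \<psi> \<and>
        bij_betw \<psi> V (carrier_vec m) \<and>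
        (\<forall>X\<in>L. \<forall>v\<in>V. \<psi> (lie_bracket X v) = \<phi> X *\<^sub>v \<psi> v))"


section \<open>The algebra \<open>\<gg>\<close> and its pieces\<close>

text \<open>Rows and columns are indexed from \<open>0\<close> to \<open>2n\<close>, so the blocks of sizes \<open>1, 2n - 1, 1\<close> are
  \<open>{0}\<close>, \<open>{1..2n - 1}\<close> and \<open>{2n}\<close>.\<close>

definition q_mat :: "nat \<Rightarrow> complex mat" where
  "q_mat n = mat (2 * n + 1) (2 * n + 1) (\<lambda>(i, j). if i + j = 2 * n then 1 else 0)"

definition Lambda1 :: "nat \<Rightarrow> complex mat" where
  "Lambda1 n = mat (2 * n + 1) (2 * n + 1) (\<lambda>(i, j).
     if (i = 0 \<and> j = 2 * n) \<or> (i = 2 * n \<and> j = 0) then 1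
     else if i = j \<and> i \<in> {1..2 * n - 1} then - 1
     else 0)"

definition theta :: "nat \<Rightarrow> complex mat \<Rightarrow> complex mat" where
  "theta n Z = Lambda1 n * Z * the (mat_inverse (Lambda1 n))"

definition g_alg :: "nat \<Rightarrow> complex mat set" where
  "g_alg n = {Z \<in> carrier_mat (2 * n + 1) (2 * n + 1).
     Z * q_mat n + q_mat n * transpose_mat Z = 0\<^sub>m (2 * n + 1) (2 * n + 1)}"

definition g0 :: "nat \<Rightarrow> complex mat set" where
  "g0 n = {Z \<in> g_alg n. theta n Z = Z}"

definition g1 :: "nat \<Rightarrow> complex mat set" where
  "g1 n = {Z \<in> g_alg n. theta n Z = - Z}"

definition g0_tilde :: "nat \<Rightarrow> complex mat set" where
  "g0_tilde n = {Z \<in> g_alg n. \<forall>i\<le>2 * n. \<forall>j\<le>2 * n.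
     i \<in> {0, 2 * n} \<or> j \<in> {0, 2 * n} \<longrightarrow> Z $$ (i, j) = 0}"

definition V_space :: "nat \<Rightarrow> complex mat set" where
  "V_space n = {Z \<in> g0 n. \<forall>i\<in>{1..2 * n - 1}. \<forall>j\<in>{1..2 * n - 1}. Z $$ (i, j) = 0}"

end

theory Submission
  imports Defs
begin

text \<open>Write \<open>J\<close> for the anti-diagonal matrix of any size. Suppose the rows of \<open>A\<close> are orthonormal for
  \<open>J\<close>, that is \<open>A J A\<^sup>T = 1\<close>, and put \<open>B = J A\<^sup>T\<close>. Then \<open>B A\<close> is the \<open>J\<close>-orthogonal projection
  onto the span of the columns of \<open>B\<close>, and \<open>X \<mapsto> A X B\<close> is a Lie isomorphism from the \<open>J\<close>-skew \<open>X\<close>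
  with \<open>X B A = X\<close> onto the skew-symmetric matrices. All three isomorphisms are instances.
  The matrix \<open>P = ((1 - \<i>) / 2) 1 + ((1 + \<i>) / 2) J\<close> is symmetric with \<open>P\<^sup>2 = J\<close> and \<open>P J P = 1\<close>: taking
  \<open>A = P\<close> gives \<open>\<gg>\<close>, composing \<open>P\<close> of size \<open>2n - 1\<close> with the restriction to the middle
  coordinates gives \<open>g0_tilde\<close>, and composing \<open>P\<close> with an orthonormal frame of the \<open>-1\<close>
  eigenspace of \<open>\<Lambda>\<^sub>1\<close> gives \<open>g0\<close>, because \<open>g0\<close> kills the \<open>+1\<close> eigenline.\<close>

section \<open>Subspaces of matrices and coordinates\<close>

text \<open>The target \<open>so_alg\<close> is skew for the dot product, while \<open>g_alg\<close>
  is skew for \<open>J\<close>; \<open>P\<close> is the congruence that trades one form for the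
  other. It sits on different sides in the two proper compressions. For \<open>g0_tilde\<close>, the
  restriction to the middle carries \<open>J\<close> of size \<open>2n + 1\<close> to
  \<open>J\<close> of size \<open>2n - 1\<close>, so the smaller \<open>P\<close> is applied after
  it. For \<open>g0\<close>, the rows of \<open>fold_mat\<close> are orthonormal for the dot
  product, so \<open>P\<close> of size \<open>2n + 1\<close> is applied before it; the span is still
  the -1 eigenspace because \<open>Lambda1\<close> commutes with \<open>J\<close>, hence with
  \<open>P\<close>. That \<open>g0\<close> kills the +1 eigenline amounts to
  \<open>so(1) = 0\<close>: an element of \<open>g0\<close> commutes with \<open>Lambda1\<close>, so
  \<open>u = e_0 + e_2n\<close> is an eigenvector of it, and skewness makes the eigenvalue zero
  because \<open>u\<close> pairs with itself to 2. The proof sees this in the entries: the last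
  column is the negative of the first. The dimensions do not come from the isomorphisms but from
  counting entries that can be prescribed freely and that determine the matrix.\<close>

lemma mat_subspaceI:
  assumes "S \<subseteq> carrier_mat N N" "0\<^sub>m N N \<in> S"
    and "\<And>X Y. X \<in> S \<Longrightarrow> Y \<in> S \<Longrightarrow> X + Y \<in> S"
    and "\<And>c X. X \<in> S \<Longrightarrow> c \<cdot>\<^sub>m X \<in> S"
  shows "mat_subspace N S"
proof -
  interpret vectorspace "class_ring :: complex ring" "mat_space N"
    by (rule matrix_vs)
  show ?thesis
    unfolding VectorSpace.subspace_def submodule_def
    using assms vectorspace_axioms module_axioms by (simp add: module_mat_simps)
qed

lemma mat_subspaceD:
  assumes "mat_subspace N S"
  shows "S \<subseteq> carrier_mat N N" "0\<^sub>m N N \<in> S"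
    and "X \<in> S \<Longrightarrow> Y \<in> S \<Longrightarrow> X + Y \<in> S"
    and "X \<in> S \<Longrightarrow> c \<cdot>\<^sub>m X \<in> S"
  using assms unfolding VectorSpace.subspace_def submodule_def
  by (auto simp: module_mat_simps)

lemma mat_vs_vectorspace:
  "mat_subspace N S \<Longrightarrow> vectorspace class_ring (mat_vs N S)"
  by (rule vectorspace.subspace_is_vs[OF matrix_vs])

lemma vec_vectorspace:
  "vectorspace class_ring (module_vec TYPE(complex) m)"
proof -
  interpret vec_space "TYPE(complex)" m .
  show ?thesis by (rule vectorspace_axioms)
qed

lemma linear_mapI:
  assumes "vectorspace class_ring U" "vectorspace class_ring W"
    and "\<And>x. x \<in> carrier U \<Longrightarrow> f x \<in> carrier W"
    and "\<And>x y. x \<in> carrier U \<Longrightarrow> y \<in> carrier U \<Longrightarrow> f (x \<oplus>\<^bsub>U\<^esub> y) = f x \<oplus>\<^bsub>W\<^esub> f y"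
    and "\<And>c x. x \<in> carrier U \<Longrightarrow> f (c \<odot>\<^bsub>U\<^esub> x) = c \<odot>\<^bsub>W\<^esub> f x"
  shows "linear_map class_ring U W f"
  using assms
  by (auto simp: linear_map_def mod_hom_def mod_hom_axioms_def LinearCombinations.module_hom_def vectorspace_def)

text \<open>Reading off the entries at the positions in \<open>I\<close> is a linear map to a
  coordinate space; \<open>determined\<close> makes it injective and \<open>arbitrary\<close> makes
  it surjective.\<close>

lemma has_dimI_coordinates:
  assumes S: "mat_subspace N S" and I: "finite I" "I \<subseteq> {..<N} \<times> {..<N}"
    and determined: "\<And>Z. Z \<in> S \<Longrightarrow> \<forall>p\<in>I. Z $$ p = 0 \<Longrightarrow> Z = 0\<^sub>m N N"
    and arbitrary: "\<And>f. \<exists>Z\<in>S. \<forall>p\<in>I. Z $$ p = f p"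
  shows "has_dim N S (card I)"
proof -
  define d where "d = card I"
  obtain h where h: "bij_betw h {..<d} I"
    using I(1) by (metis d_def finite_same_card_bij card_lessThan finite_lessThan)
  define coords where "coords = (\<lambda>Z :: complex mat. vec d (\<lambda>k. Z $$ h k))"
  note SD = mat_subspaceD[OF S]
  have carr: "Z \<in> S \<Longrightarrow> Z \<in> carrier_mat N N" for Z using SD(1) by blast
  have hI: "fst (h k) < N" "snd (h k) < N" if "k < d" for k
    using that h I(2) by (auto simp: bij_betw_def dest!: subsetD)+
  have coords_add: "coords (X + Y) = coords X + coords Y" if "X \<in> S" "Y \<in> S" for X Y
  proof (rule eq_vecI)
    fix k assume "k < dim_vec (coords X + coords Y)"
    then show "coords (X + Y) $ k = (coords X + coords Y) $ k"
      using hI[of k] carr[OF that(1)] carr[OF that(2)] by (cases "h k") (simp add: coords_def)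
  qed (simp add: coords_def)
  have coords_smult: "coords (c \<cdot>\<^sub>m X) = c \<cdot>\<^sub>v coords X" if "X \<in> S" for c X
  proof (rule eq_vecI)
    fix k assume "k < dim_vec (c \<cdot>\<^sub>v coords X)"
    then show "coords (c \<cdot>\<^sub>m X) $ k = (c \<cdot>\<^sub>v coords X) $ k"
      using hI[of k] carr[OF that] by (cases "h k") (simp add: coords_def)
  qed (simp add: coords_def)
  have inj: "X = Y" if "X \<in> S" "Y \<in> S" "coords X = coords Y" for X Y
  proof -
    \<comment> \<open>The difference is written this way because the closure facts for
      \<open>S\<close> speak of sums and scalar multiples only.\<close>
    have "X + (-1) \<cdot>\<^sub>m Y \<in> S" using SD that by blast
    moreover have "(X + (-1) \<cdot>\<^sub>m Y) $$ p = 0" if "p \<in> I" for p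
    proof -
      obtain k where k: "k < d" "p = h k" using h \<open>p \<in> I\<close> by (auto simp: bij_betw_def)
      have "X $$ p = Y $$ p"
        using arg_cong[OF \<open>coords X = coords Y\<close>, of "\<lambda>v. v $ k"] k by (simp add: coords_def)
      moreover have "(X + (-1) \<cdot>\<^sub>m Y) $$ p = X $$ p - Y $$ p"
        using carr[OF \<open>X \<in> S\<close>] carr[OF \<open>Y \<in> S\<close>] hI[OF k(1)] k(2) by (cases "h k") auto
      ultimately show ?thesis by simp
    qed
    ultimately have "X + (-1) \<cdot>\<^sub>m Y = 0\<^sub>m N N" using determined by blast
    then have "(X + (-1) \<cdot>\<^sub>m Y) $$ (i, j) = 0" if "i < N" "j < N" for i j
      using that by simp
    then have "X $$ (i, j) = Y $$ (i, j)" if "i < N" "j < N" for i j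
      using that carr[OF \<open>X \<in> S\<close>] carr[OF \<open>Y \<in> S\<close>] by force
    then show ?thesis using carr[OF \<open>X \<in> S\<close>] carr[OF \<open>Y \<in> S\<close>] by (intro eq_matI) auto
  qed
  have surj: "\<exists>Z\<in>S. coords Z = w" if "w \<in> carrier_vec d" for w
  proof -
    obtain Z where Z: "Z \<in> S" "\<forall>p\<in>I. Z $$ p = w $ (inv_into {..<d} h p)"
      using arbitrary[of "\<lambda>p. w $ (inv_into {..<d} h p)"] by blast
    have "Z $$ h k = w $ k" if "k < d" for k
    proof -
      have "h k \<in> I" "inv_into {..<d} h (h k) = k"
        using h that by (auto simp: bij_betw_def)
      then show ?thesis using Z(2) by simp
    qed
    then show ?thesis using Z that by (intro bexI[of _ Z]) (auto simp: coords_def)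
  qed
  have bij: "bij_betw coords S (carrier_vec d)"
    unfolding bij_betw_def using inj surj by (auto simp: inj_on_def coords_def image_iff) metis
  \<comment> \<open>The inverse is used because finite dimension is transported from the source of a
    surjection to its target, and it is known for the coordinate space.\<close>
  define T where "T = inv_into S coords"
  have T: "T w \<in> S" "coords (T w) = w" if "w \<in> carrier_vec d" for w
    using bij that by (auto simp: T_def bij_betw_def inv_into_into f_inv_into_f)
  interpret vec_space "TYPE(complex)" d .
  interpret T: linear_map class_ring "module_vec TYPE(complex) d" "mat_vs N S" T
    using T SD
    by (intro linear_mapI vec_vectorspace mat_vs_vectorspace S)
       (auto simp: module_vec_simps module_mat_simps coords_add coords_smult intro!: inj)
  have T_bij: "bij_betw T (carrier_vec d) S" unfolding T_def by (rule bij_betw_inv_into[OF bij])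
  then have "inj_on T (carrier (module_vec TYPE(complex) d))"
    and surj: "T ` carrier (module_vec TYPE(complex) d) = carrier (mat_vs N S)"
    by (auto simp: bij_betw_def module_vec_simps)
  then show ?thesis
    using T.dim_eq[OF fin_dim _ surj] T.surj_fin_dim[OF fin_dim surj] S
    unfolding has_dim_def by (simp add: dim_is_n d_def[symmetric])
qed

section \<open>The reversal matrix and its square root\<close>

text \<open>Conditions on dimensions, in place of carriers with unknown sizes, let the simplifier
  reassociate products of rectangular matrices.\<close>

lemma assoc_mult_mat_dim:
  "dim_col A = dim_row B \<Longrightarrow> dim_col B = dim_row C \<Longrightarrow>
     A * B * C = A * (B * (C :: 'a :: semiring_0 mat))"
  by (rule assoc_mult_mat[of _ "dim_row A" "dim_row B" _ "dim_row C" _ "dim_col C"]) auto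

lemma transpose_mult_dim:
  "dim_col A = dim_row B \<Longrightarrow>
     transpose_mat (A * B) = transpose_mat B * transpose_mat (A :: 'a :: comm_semiring_0 mat)"
  by (rule transpose_mult[of _ "dim_row A" "dim_row B" _ "dim_col B"]) auto

lemma lie_bracket_carrier [simp]:
  "X \<in> carrier_mat m m \<Longrightarrow> Y \<in> carrier_mat m m \<Longrightarrow> lie_bracket X Y \<in> carrier_mat m m"
  unfolding lie_bracket_def by (intro minus_carrier_mat mult_carrier_mat)

definition reversal_mat :: "nat \<Rightarrow> complex mat" where
  "reversal_mat m = mat m m (\<lambda>(i, j). if i + j + 1 = m then 1 else 0)"

lemma reversal_mat_carrier [simp]: "reversal_mat m \<in> carrier_mat m m"
  and reversal_mat_dim [simp]: "dim_row (reversal_mat m) = m" "dim_col (reversal_mat m) = m"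
  by (simp_all add: reversal_mat_def)

lemma reversal_mat_transpose [simp]: "transpose_mat (reversal_mat m) = reversal_mat m"
  by (rule eq_matI) (auto simp: reversal_mat_def)

lemma index_reversal_mat_mult:
  assumes "Z \<in> carrier_mat m k" "i < m" "j < k"
  shows "(reversal_mat m * Z) $$ (i, j) = Z $$ (m - 1 - i, j)"
proof -
  have "(reversal_mat m * Z) $$ (i, j) = (\<Sum>l<m. (if i + l + 1 = m then 1 else 0) * Z $$ (l, j))"
    using assms by (simp add: reversal_mat_def scalar_prod_def lessThan_atLeast0)
  also have "\<dots> = (\<Sum>l<m. if l = m - 1 - i then Z $$ (l, j) else 0)"
    using assms by (intro sum.cong) auto
  also have "\<dots> = Z $$ (m - 1 - i, j)" using assms by simp
  finally show ?thesis .
qed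

lemma index_mult_reversal_mat:
  assumes "Z \<in> carrier_mat k m" "i < k" "j < m"
  shows "(Z * reversal_mat m) $$ (i, j) = Z $$ (i, m - 1 - j)"
proof -
  have "(Z * reversal_mat m) $$ (i, j) = (\<Sum>l<m. Z $$ (i, l) * (if l + j + 1 = m then 1 else 0))"
    using assms by (simp add: reversal_mat_def scalar_prod_def lessThan_atLeast0)
  also have "\<dots> = (\<Sum>l<m. if l = m - 1 - j then Z $$ (i, l) else 0)"
    using assms by (intro sum.cong) auto
  also have "\<dots> = Z $$ (i, m - 1 - j)" using assms by simp
  finally show ?thesis .
qed

lemma reversal_mat_involution [simp]: "reversal_mat m * reversal_mat m = 1\<^sub>m m"
  by (rule eq_matI) (auto simp: index_reversal_mat_mult[of _ m m] simp del: index_mult_mat(1), auto simp: reversal_mat_def)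

lemma reversal_mat_cancel [simp]:
  assumes "dim_row X = m"
  shows "reversal_mat m * (reversal_mat m * X) = X"
  using assms assoc_mult_mat_dim[of "reversal_mat m" "reversal_mat m" X] by simp

definition so_rev :: "nat \<Rightarrow> complex mat set" where
  "so_rev m = {Z \<in> carrier_mat m m.
     Z * reversal_mat m + reversal_mat m * transpose_mat Z = 0\<^sub>m m m}"

text \<open>\<open>J Z^T\<close> is the transpose of \<open>Z J\<close>, so the defining equation
  says that \<open>Z J\<close> is skew-symmetric. Multiplication by \<open>J\<close> reverses the
  column index, which turns this into skewness under reflection in the anti-diagonal.\<close>

lemma so_rev_iff_index:
  "Z \<in> so_rev m \<longleftrightarrow>
     Z \<in> carrier_mat m m \<and> (\<forall>i<m. \<forall>j<m. Z $$ (i, j) = - Z $$ (m - 1 - j, m - 1 - i))"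
proof (cases "Z \<in> carrier_mat m m")
  case True
  have "Z \<in> so_rev m \<longleftrightarrow> (\<forall>i<m. \<forall>j<m. Z $$ (i, m - 1 - j) + Z $$ (j, m - 1 - i) = 0)"
    using True
    by (auto simp: so_rev_def mat_eq_iff index_reversal_mat_mult[of _ m m]
        index_mult_reversal_mat[of _ m m] simp del: index_mult_mat(1))
  also have "\<dots> \<longleftrightarrow> (\<forall>i<m. \<forall>j<m. Z $$ (i, j) = - Z $$ (m - 1 - j, m - 1 - i))"
  proof safe
    fix i j assume *: "\<forall>i<m. \<forall>j<m. Z $$ (i, m - 1 - j) + Z $$ (j, m - 1 - i) = 0" "i < m" "j < m"
    then have "m - 1 - j < m" "m - 1 - (m - 1 - j) = j" by auto
    with * show "Z $$ (i, j) = - Z $$ (m - 1 - j, m - 1 - i)"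
      by (metis eq_neg_iff_add_eq_0)
  next
    fix i j
    assume *: "\<forall>i<m. \<forall>j<m. Z $$ (i, j) = - Z $$ (m - 1 - j, m - 1 - i)" "i < m" "j < m"
    then have "m - 1 - j < m" "m - 1 - (m - 1 - j) = j" by auto
    with * show "Z $$ (i, m - 1 - j) + Z $$ (j, m - 1 - i) = 0"
      by (metis eq_neg_iff_add_eq_0)
  qed
  finally show ?thesis using True by simp
qed (simp add: so_rev_def)

text \<open>On the eigenspaces of \<open>J\<close> for 1 and -1 this acts by the sum and the
  difference of the two coefficients, that is by 1 and \<open>- \<i>\<close>. These are square roots
  of 1 and -1.\<close>

definition reversal_root :: "nat \<Rightarrow> complex mat" where
  "reversal_root m = ((1 - \<i>) / 2) \<cdot>\<^sub>m 1\<^sub>m m + ((1 + \<i>) / 2) \<cdot>\<^sub>m reversal_mat m"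

lemma reversal_root_carrier [simp]: "reversal_root m \<in> carrier_mat m m"
  by (simp add: reversal_root_def)

lemma reversal_root_transpose [simp]: "transpose_mat (reversal_root m) = reversal_root m"
  by (rule eq_matI) (auto simp: reversal_root_def reversal_mat_def)

lemma reversal_root_square [simp]: "reversal_root m * reversal_root m = reversal_mat m"
proof -
  let ?a = "(1 - \<i>) / 2" and ?b = "(1 + \<i>) / 2" and ?J = "reversal_mat m"
  have "reversal_root m * reversal_root m =
      ?a \<cdot>\<^sub>m (?a \<cdot>\<^sub>m 1\<^sub>m m + ?b \<cdot>\<^sub>m ?J) + ?b \<cdot>\<^sub>m (?a \<cdot>\<^sub>m ?J + ?b \<cdot>\<^sub>m 1\<^sub>m m)"
    unfolding reversal_root_def
    by (simp add: add_mult_distrib_mat[of _ m m _ _ m] mult_add_distrib_mat[of _ m m _ m]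
        mult_smult_distrib[of _ m m _ m] mult_smult_assoc_mat[of _ m m _ m])
  also have "\<dots> = reversal_mat m"
    \<comment> \<open>The coefficients satisfy \<open>a\<^sup>2 + b\<^sup>2 = 0\<close> and
      \<open>2 a b = 1\<close>.\<close>
    by (rule eq_matI) (auto simp: power2_eq_square field_simps complex_eq_iff)
  finally show ?thesis .
qed

text \<open>Both sides are the cube of the root.\<close>

lemma reversal_root_commute:
  "reversal_mat m * reversal_root m = reversal_root m * reversal_mat m"
  using assoc_mult_mat[of "reversal_root m" m m "reversal_root m" m "reversal_root m" m]
  by simp

lemma reversal_root_conj [simp]:
  "reversal_root m * (reversal_mat m * reversal_root m) = 1\<^sub>m m"
proof -
  have "reversal_root m * (reversal_root m * reversal_mat m) = 1\<^sub>m m"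
    using assoc_mult_mat[of "reversal_root m" m m "reversal_root m" m "reversal_mat m" m] by simp
  then show ?thesis by (simp only: reversal_root_commute)
qed

section \<open>The Lie algebra of \<open>J\<close>-skew matrices\<close>

lemma so_rev_index:
  assumes "X \<in> so_rev m" "i < m" "j < m"
  shows "X $$ (i, j) = - X $$ (m - 1 - j, m - 1 - i)"
  using assms unfolding so_rev_iff_index by blast

lemma so_rev_mult_reversal:
  assumes "X \<in> so_rev m"
  shows "reversal_mat m * transpose_mat X = - (X * reversal_mat m)"
proof -
  have X: "X \<in> carrier_mat m m" and *: "X * reversal_mat m + reversal_mat m * transpose_mat X = 0\<^sub>m m m"
    using assms by (simp_all add: so_rev_def)
  show ?thesis
  proof (rule eq_matI)
    fix i j assume "i < dim_row (- (X * reversal_mat m))" "j < dim_col (- (X * reversal_mat m))"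
    then have ij: "i < m" "j < m" using X by auto
    with * have "(X * reversal_mat m + reversal_mat m * transpose_mat X) $$ (i, j) = 0" by simp
    with X ij show "(reversal_mat m * transpose_mat X) $$ (i, j) = (- (X * reversal_mat m)) $$ (i, j)"
      by (simp add: eq_neg_iff_add_eq_0 add.commute del: index_mult_mat(1))
  qed (use X in auto)
qed

text \<open>\<open>J X^T J\<close> is the adjoint of \<open>X\<close> for the bilinear form
  \<open>J\<close>. Being skew for an adjoint is easier to combine with products than the defining
  equation, because an adjoint reverses products.\<close>

lemma so_rev_conj_transpose:
  assumes "X \<in> so_rev m"
  shows "reversal_mat m * transpose_mat X * reversal_mat m = - X"
proof -
  have X: "X \<in> carrier_mat m m" using assms by (simp add: so_rev_def)
  show ?thesis
    unfolding so_rev_mult_reversal[OF assms]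
    using X assoc_mult_mat[OF X reversal_mat_carrier reversal_mat_carrier]
    by simp
qed

lemma so_rev_iff_conj_transpose:
  "X \<in> so_rev m \<longleftrightarrow>
     X \<in> carrier_mat m m \<and> reversal_mat m * transpose_mat X * reversal_mat m = - X"
proof safe
  assume X: "X \<in> carrier_mat m m" and *: "reversal_mat m * transpose_mat X * reversal_mat m = - X"
  have "reversal_mat m * transpose_mat X = reversal_mat m * transpose_mat X * reversal_mat m * reversal_mat m"
    using X by (simp add: assoc_mult_mat_dim)
  also have "\<dots> = - (X * reversal_mat m)" using X unfolding * by simp
  finally show "X \<in> so_rev m"
    using X by (auto simp: so_rev_def intro!: eq_matI)
qed (simp_all add: so_rev_conj_transpose so_rev_def)

lemma so_rev_lie_algebra: "mat_lie_algebra m (so_rev m)"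
proof -
  have "mat_subspace m (so_rev m)"
  proof (rule mat_subspaceI)
    fix X Y assume XY: "X \<in> so_rev m" "Y \<in> so_rev m"
    then have carr: "X \<in> carrier_mat m m" "Y \<in> carrier_mat m m" by (simp_all add: so_rev_def)
    show "X + Y \<in> so_rev m"
      unfolding so_rev_iff_index
    proof (intro conjI allI impI)
      fix i j assume ij: "i < m" "j < m"
      show "(X + Y) $$ (i, j) = - (X + Y) $$ (m - 1 - j, m - 1 - i)"
        using carr ij so_rev_index[OF XY(1) ij] so_rev_index[OF XY(2) ij] by simp
    qed (use carr in simp)
  next
    fix c X assume X: "X \<in> so_rev m"
    then have carr: "X \<in> carrier_mat m m" by (simp add: so_rev_def)
    show "c \<cdot>\<^sub>m X \<in> so_rev m"
      unfolding so_rev_iff_index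
    proof (intro conjI allI impI)
      fix i j assume ij: "i < m" "j < m"
      show "(c \<cdot>\<^sub>m X) $$ (i, j) = - (c \<cdot>\<^sub>m X) $$ (m - 1 - j, m - 1 - i)"
        using carr ij so_rev_index[OF X ij] by simp
    qed (use carr in simp)
  qed (auto simp: so_rev_iff_index)
  moreover have "lie_bracket X Y \<in> so_rev m" if "X \<in> so_rev m" "Y \<in> so_rev m" for X Y
  proof -
    let ?J = "reversal_mat m"
    have X: "X \<in> carrier_mat m m" and Y: "Y \<in> carrier_mat m m"
      using that by (simp_all add: so_rev_def)
    \<comment> \<open>The adjoint reverses the product and the two minus signs cancel; a commutator
      therefore goes to its negative.\<close>
    have conj_mult: "?J * transpose_mat (U * W) * ?J = W * U"
      if "U \<in> so_rev m" "W \<in> so_rev m" for U W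
    proof -
      have U: "U \<in> carrier_mat m m" and W: "W \<in> carrier_mat m m"
        using that by (simp_all add: so_rev_def)
      have "?J * transpose_mat (U * W) * ?J =
          (?J * transpose_mat W * ?J) * (?J * transpose_mat U * ?J)"
        using U W by (simp add: transpose_mult_dim assoc_mult_mat_dim)
      also have "\<dots> = W * U"
        using U W by (simp add: so_rev_conj_transpose that)
      finally show ?thesis .
    qed
    have "?J * transpose_mat (lie_bracket X Y) * ?J =
        ?J * transpose_mat (X * Y) * ?J - ?J * transpose_mat (Y * X) * ?J"
      unfolding lie_bracket_def transpose_minus[OF mult_carrier_mat[OF X Y] mult_carrier_mat[OF Y X]]
      using X Y
      by (subst mult_minus_distrib_mat[of _ m m _ m], simp_all)
        (subst minus_mult_distrib_mat[of _ m m _ _ m], auto intro: carrier_matI)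
    also have "\<dots> = - lie_bracket X Y"
      unfolding conj_mult[OF that] conj_mult[OF that(2,1)] lie_bracket_def
      using X Y by (intro eq_matI) (simp_all del: index_mult_mat(1))
    finally show ?thesis
      using X Y by (simp add: so_rev_iff_conj_transpose)
  qed
  ultimately show ?thesis by (simp add: mat_lie_algebra_def)
qed

section \<open>Compression to an orthonormal frame\<close>

text \<open>Since \<open>B A\<close> acts as the identity on \<open>L\<close>, it can be inserted or
  removed next to an element of \<open>L\<close>: this makes \<open>X \<mapsto> A X B\<close>
  multiplicative and \<open>Y \<mapsto> B Y A\<close> its inverse. Products need not lie in
  \<open>L\<close>, so multiplicativity is shown for them before passing to brackets.\<close>

lemma lie_isomorphismI_mult:
  assumes L: "mat_lie_algebra N L" and L': "mat_lie_algebra M L'"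
    and A: "A \<in> carrier_mat M N" and B: "B \<in> carrier_mat N M" and AB: "A * B = 1\<^sub>m M"
    and maps: "\<And>X. X \<in> L \<Longrightarrow> A * X * B \<in> L'" "\<And>Y. Y \<in> L' \<Longrightarrow> B * Y * A \<in> L"
    and fixed: "\<And>X. X \<in> L \<Longrightarrow> X * (B * A) = X" "\<And>X. X \<in> L \<Longrightarrow> B * A * X = X"
  shows "lie_isomorphism N L M L' (\<lambda>X. A * X * B)"
proof -
  have subsp: "mat_subspace N L" "mat_subspace M L'" using L L' by (simp_all add: mat_lie_algebra_def)
  have carr: "X \<in> L \<Longrightarrow> X \<in> carrier_mat N N" "Y \<in> L' \<Longrightarrow> Y \<in> carrier_mat M M" for X Y
    using mat_subspaceD(1)[OF subsp(1)] mat_subspaceD(1)[OF subsp(2)] by blast+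
  have add: "A * (X + Y) * B = A * X * B + A * Y * B"
    if "X \<in> carrier_mat N N" "Y \<in> carrier_mat N N" for X Y
    using that A B
    by (simp add: mult_add_distrib_mat[of _ M N _ N] add_mult_distrib_mat[of _ M N _ _ M])
  have minus: "A * (X - Y) * B = A * X * B - A * Y * B"
    if "X \<in> carrier_mat N N" "Y \<in> carrier_mat N N" for X Y
    using that A B
    by (simp add: mult_minus_distrib_mat[of _ M N _ N] minus_mult_distrib_mat[of _ M N _ _ M])
  have smult: "A * (c \<cdot>\<^sub>m X) * B = c \<cdot>\<^sub>m (A * X * B)" if "X \<in> carrier_mat N N" for c X
    using that A B
    by (simp add: mult_smult_distrib[of _ M N _ N] mult_smult_assoc_mat[of _ M N _ M])
  have linear: "linear_map class_ring (mat_vs N L) (mat_vs M L') (\<lambda>X. A * X * B)"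
    using carr maps
    by (intro linear_mapI mat_vs_vectorspace subsp) (auto simp: module_mat_simps add smult)
  have inv1: "B * (A * X * B) * A = X" if "X \<in> L" for X
  proof -
    have "B * (A * X * B) * A = B * A * X * (B * A)"
      using A B carr(1)[OF that]
      by (simp add: assoc_mult_mat_dim)
    then show ?thesis using fixed that by simp
  qed
  have inv2: "A * (B * Y * A) * B = Y" if "Y \<in> L'" for Y
  proof -
    have "A * (B * Y * A) * B = A * B * Y * (A * B)"
      using A B carr(2)[OF that]
      by (simp add: assoc_mult_mat_dim)
    then show ?thesis using AB carr(2)[OF that] by simp
  qed
  have bij: "bij_betw (\<lambda>X. A * X * B) L L'"
    by (rule bij_betw_byWitness[where f' = "\<lambda>Y. B * Y * A"]) (use maps inv1 inv2 in auto)
  have mult: "A * (X * Y) * B = (A * X * B) * (A * Y * B)" if "X \<in> L" "Y \<in> L" for X Y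
  proof -
    note c = carr(1)[OF that(1)] carr(1)[OF that(2)]
    have "(A * X * B) * (A * Y * B) = A * (X * (B * A)) * Y * B"
      using A B c
      by (simp add: assoc_mult_mat_dim)
    also have "\<dots> = A * (X * Y) * B"
      using A c fixed(1)[OF that(1)] by (simp add: assoc_mult_mat_dim)
    finally show ?thesis by simp
  qed
  have "A * lie_bracket X Y * B = lie_bracket (A * X * B) (A * Y * B)" if "X \<in> L" "Y \<in> L" for X Y
    using that carr(1)[OF that(1)] carr(1)[OF that(2)]
    by (simp add: lie_bracket_def minus[of "X * Y" "Y * X"] mult)
  then show ?thesis unfolding lie_isomorphism_def using L L' linear bij by blast
qed

lemma so_alg_lie_algebra: "mat_lie_algebra m (so_alg m)"
proof -
  have "mat_subspace m (so_alg m)"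
  proof (rule mat_subspaceI)
    fix c X assume X: "X \<in> so_alg m"
    have "transpose_mat (c \<cdot>\<^sub>m X) = c \<cdot>\<^sub>m transpose_mat X" by (rule eq_matI) auto
    also have "\<dots> = - (c \<cdot>\<^sub>m X)" using X by (auto simp: so_alg_def intro!: eq_matI)
    finally show "c \<cdot>\<^sub>m X \<in> so_alg m" using X by (simp add: so_alg_def)
  qed (auto simp: so_alg_def transpose_add[of _ m m] intro!: eq_matI)
  moreover have "lie_bracket X Y \<in> so_alg m" if "X \<in> so_alg m" "Y \<in> so_alg m" for X Y
  proof -
    have X: "X \<in> carrier_mat m m" "transpose_mat X = - X" and Y: "Y \<in> carrier_mat m m" "transpose_mat Y = - Y"
      using that by (simp_all add: so_alg_def)
    have "transpose_mat (lie_bracket X Y) = Y * X - X * Y"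
      unfolding lie_bracket_def
      using X Y by (simp add: transpose_minus[of _ m m] transpose_mult[of _ m m _ m])
    also have "\<dots> = - lie_bracket X Y"
      unfolding lie_bracket_def using X(1) Y(1) by (intro eq_matI) (simp_all del: index_mult_mat(1))
    finally show ?thesis using X Y by (simp add: so_alg_def)
  qed
  ultimately show ?thesis by (simp add: mat_lie_algebra_def)
qed

text \<open>Take adjoints in \<open>X K = X\<close>: the self-adjoint \<open>K\<close> moves to the
  left, and both occurrences of \<open>X\<close> change sign.\<close>

lemma so_rev_fixed_left:
  assumes X: "X \<in> so_rev N" and K: "K \<in> carrier_mat N N"
    and K_sym: "reversal_mat N * transpose_mat K * reversal_mat N = K"
    and fixed: "X * K = X"
  shows "K * X = X"
proof -
  let ?J = "reversal_mat N"
  have c: "X \<in> carrier_mat N N" using X by (simp add: so_rev_def)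
  have "- X = ?J * transpose_mat (X * K) * ?J"
    using fixed so_rev_conj_transpose[OF X] by simp
  also have "\<dots> = (?J * transpose_mat K * ?J) * (?J * transpose_mat X * ?J)"
    using c K by (simp add: transpose_mult_dim assoc_mult_mat_dim)
  also have "\<dots> = - (K * X)"
    using c K by (simp add: K_sym so_rev_conj_transpose[OF X])
  finally show ?thesis by simp
qed

text \<open>The identities \<open>J A^T = B\<close> and \<open>B^T J = A\<close> make the adjoint of
  \<open>B Y A\<close> equal to \<open>B Y^T A\<close> and the transpose of \<open>A X B\<close>
  equal to \<open>A (J X^T J) B\<close>, so each kind of skewness passes to the other. They also
  make \<open>B A\<close> self-adjoint, which turns the one-sided condition in \<open>L\<close> into
  a two-sided one.\<close>

lemma so_rev_compression:
  assumes A: "A \<in> carrier_mat M N" and iso: "A * (reversal_mat N * transpose_mat A) = 1\<^sub>m M"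
  defines "B \<equiv> reversal_mat N * transpose_mat A"
  defines "L \<equiv> {X \<in> so_rev N. X * (B * A) = X}"
  shows "mat_lie_algebra N L"
    and "lie_isomorphism N L M (so_alg M) (\<lambda>X. A * X * B)"
    and "\<And>X. X \<in> L \<Longrightarrow> B * A * X = X"
proof -
  let ?J = "reversal_mat N"
  have B: "B \<in> carrier_mat N M" using A unfolding B_def by auto
  have BT: "transpose_mat B = A * ?J" using A by (simp add: B_def transpose_mult[of _ N N _ M])
  have JBT: "?J * transpose_mat A = B" by (simp add: B_def)
  have AT: "transpose_mat A = ?J * B"
    using A assoc_mult_mat[of ?J N N ?J N "transpose_mat A" M] by (simp add: B_def)
  have BA: "B * A \<in> carrier_mat N N" using A B by auto
  have K_sym: "?J * transpose_mat (B * A) * ?J = B * A"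
  proof -
    have "?J * transpose_mat (B * A) * ?J = (?J * transpose_mat A) * (transpose_mat B * ?J)"
      using A B by (simp add: transpose_mult_dim assoc_mult_mat_dim)
    also have "transpose_mat B * ?J = A"
      using A by (simp add: BT assoc_mult_mat_dim)
    finally show ?thesis by (simp add: JBT)
  qed
  show left: "B * A * X = X" if "X \<in> L" for X
    using so_rev_fixed_left[OF _ BA K_sym] that by (simp add: L_def)
  have so: "mat_subspace N (so_rev N)" "\<forall>X\<in>so_rev N. \<forall>Y\<in>so_rev N. lie_bracket X Y \<in> so_rev N"
    using so_rev_lie_algebra[of N] by (simp_all add: mat_lie_algebra_def)
  have c: "X \<in> L \<Longrightarrow> X \<in> carrier_mat N N" for X by (simp add: L_def so_rev_def)
  show lie: "mat_lie_algebra N L"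
    unfolding mat_lie_algebra_def
  proof (intro conjI ballI mat_subspaceI)
    show "L \<subseteq> carrier_mat N N" using c by blast
    show "0\<^sub>m N N \<in> L" using mat_subspaceD(2)[OF so(1)] left_mult_zero_mat[OF BA] by (simp add: L_def)
  next
    fix X Y assume "X \<in> L" "Y \<in> L"
    then show "X + Y \<in> L"
      using mat_subspaceD(3)[OF so(1), of X Y] BA c[of X] c[of Y]
      by (simp add: L_def add_mult_distrib_mat[of _ N N _ _ N])
  next
    fix k X assume "X \<in> L"
    then show "k \<cdot>\<^sub>m X \<in> L"
      using mat_subspaceD(4)[OF so(1), of X k] BA c[of X]
      by (simp add: L_def mult_smult_assoc_mat[of _ N N _ N])
  next
    fix X Y assume XY: "X \<in> L" "Y \<in> L"
    have "lie_bracket X Y * (B * A) = lie_bracket X Y"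
      using XY BA c[of X] c[of Y] unfolding L_def
      by (simp add: lie_bracket_def minus_mult_distrib_mat[of _ N N _ _ N] assoc_mult_mat_dim)
    then show "lie_bracket X Y \<in> L" using XY so by (simp add: L_def)
  qed
  show "lie_isomorphism N L M (so_alg M) (\<lambda>X. A * X * B)"
  proof (rule lie_isomorphismI_mult[OF lie so_alg_lie_algebra A B])
    show AB: "A * B = 1\<^sub>m M" using iso by (simp add: B_def)
    show "A * X * B \<in> so_alg M" if "X \<in> L" for X
    proof -
      have X: "X \<in> carrier_mat N N" using c that by blast
      have "transpose_mat (A * X * B) = (A * ?J) * (transpose_mat X * (?J * B))"
        using A B X by (simp add: transpose_mult_dim assoc_mult_mat_dim BT AT)
      also have "\<dots> = A * ((?J * transpose_mat X * ?J) * B)"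
        using A B X by (simp add: assoc_mult_mat_dim)
      also have "\<dots> = - (A * X * B)"
        using A B X that by (subst so_rev_conj_transpose) (simp_all add: L_def assoc_mult_mat_dim)
      finally show ?thesis using A B X by (simp add: so_alg_def)
    qed
    show "B * Y * A \<in> L" if "Y \<in> so_alg M" for Y
    proof -
      have Y: "Y \<in> carrier_mat M M" "transpose_mat Y = - Y" using that by (simp_all add: so_alg_def)
      have "?J * transpose_mat (B * Y * A) * ?J = (?J * transpose_mat A) * transpose_mat Y * (transpose_mat B * ?J)"
        using A B Y(1)
        by (simp add: transpose_mult_dim assoc_mult_mat_dim)
      also have "transpose_mat B * ?J = A"
        using A by (simp add: BT assoc_mult_mat_dim)
      finally have "?J * transpose_mat (B * Y * A) * ?J = - (B * Y * A)"
        using A B Y by (simp add: JBT)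
      moreover have "B * Y * A * (B * A) = B * Y * A"
      \<comment> \<open>The factor \<open>A B = 1\<close> appears in the middle, so every
        \<open>B Y A\<close> meets the condition that cuts out \<open>L\<close>.\<close>
      proof -
        have "B * Y * A * (B * A) = B * Y * (A * B * A)"
          using A B Y(1) by (simp add: assoc_mult_mat_dim)
        then show ?thesis using A by (simp add: AB)
      qed
      ultimately show ?thesis using A B Y(1) by (simp add: L_def so_rev_iff_conj_transpose)
    qed
  qed (use left L_def in auto)
qed

section \<open>The involution\<close>

lemma q_mat_eq_reversal: "q_mat n = reversal_mat (2 * n + 1)"
  by (rule eq_matI) (auto simp: q_mat_def reversal_mat_def)

lemma g_alg_eq_so_rev: "g_alg n = so_rev (2 * n + 1)"
  by (simp add: g_alg_def so_rev_def q_mat_eq_reversal)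

text \<open>\<open>Lambda1\<close> is a signed permutation matrix: this is its permutation, and
  \<open>end_sign\<close> gives its signs. Conjugation by \<open>Lambda1\<close> then acts on single
  entries.\<close>

definition swap_ends :: "nat \<Rightarrow> nat \<Rightarrow> nat" where
  "swap_ends n i = (if i = 0 then 2 * n else if i = 2 * n then 0 else i)"

definition end_sign :: "nat \<Rightarrow> nat \<Rightarrow> complex" where
  "end_sign n i = (if i = 0 \<or> i = 2 * n then 1 else - 1)"

lemma swap_ends_simps [simp]:
  "swap_ends n 0 = 2 * n" "swap_ends n (2 * n) = 0" "swap_ends n (swap_ends n i) = i"
  by (auto simp: swap_ends_def)

lemma swap_ends_less [simp]: "i < Suc (2 * n) \<Longrightarrow> swap_ends n i < Suc (2 * n)"
  by (auto simp: swap_ends_def)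

lemma end_sign_simps [simp]:
  "end_sign n 0 = 1" "end_sign n (2 * n) = 1" "end_sign n (swap_ends n i) = end_sign n i"
  "end_sign n i * end_sign n i = 1" "end_sign n i * (end_sign n i * c) = c"
  by (auto simp: swap_ends_def end_sign_def)

lemma middle_simps:
  "0 < i \<Longrightarrow> i < 2 * n \<Longrightarrow> swap_ends n i = i" "0 < i \<Longrightarrow> i < 2 * n \<Longrightarrow> end_sign n i = - 1"
  by (auto simp: swap_ends_def end_sign_def)

lemma swap_ends_reverse: "i < Suc (2 * n) \<Longrightarrow> swap_ends n (2 * n - i) = 2 * n - swap_ends n i"
  by (auto simp: swap_ends_def)

lemma end_sign_reverse: "i < Suc (2 * n) \<Longrightarrow> end_sign n (2 * n - i) = end_sign n i"
proof -
  assume "i < Suc (2 * n)"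
  then have "(2 * n - i = 0 \<or> 2 * n - i = 2 * n) = (i = 0 \<or> i = 2 * n)" by linarith
  then show ?thesis by (simp only: end_sign_def)
qed

lemma Lambda1_carrier [simp]: "Lambda1 n \<in> carrier_mat (Suc (2 * n)) (Suc (2 * n))"
  and Lambda1_dim [simp]: "dim_row (Lambda1 n) = Suc (2 * n)" "dim_col (Lambda1 n) = Suc (2 * n)"
  by (simp_all add: Lambda1_def)

lemma Lambda1_index:
  assumes "0 < n" "i < Suc (2 * n)" "j < Suc (2 * n)"
  shows "Lambda1 n $$ (i, j) = (if j = swap_ends n i then end_sign n i else 0)"
  using assms by (auto simp: Lambda1_def swap_ends_def end_sign_def)

lemma index_Lambda1_mult:
  assumes "0 < n" "Z \<in> carrier_mat (Suc (2 * n)) k" "i < Suc (2 * n)" "j < k"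
  shows "(Lambda1 n * Z) $$ (i, j) = end_sign n i * Z $$ (swap_ends n i, j)"
proof -
  have "(Lambda1 n * Z) $$ (i, j) = (\<Sum>l<Suc (2 * n). Lambda1 n $$ (i, l) * Z $$ (l, j))"
    using assms by (simp add: scalar_prod_def lessThan_atLeast0 del: sum.lessThan_Suc sum.op_ivl_Suc)
  also have "\<dots> = (\<Sum>l<Suc (2 * n). if l = swap_ends n i then end_sign n i * Z $$ (l, j) else 0)"
    using assms by (intro sum.cong) (auto simp: Lambda1_index)
  also have "\<dots> = end_sign n i * Z $$ (swap_ends n i, j)"
    using assms by (simp del: sum.lessThan_Suc)
  finally show ?thesis .
qed

lemma index_mult_Lambda1:
  assumes "0 < n" "Z \<in> carrier_mat k (Suc (2 * n))" "i < k" "j < Suc (2 * n)"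
  shows "(Z * Lambda1 n) $$ (i, j) = end_sign n j * Z $$ (i, swap_ends n j)"
proof -
  have "(Z * Lambda1 n) $$ (i, j) = (\<Sum>l<Suc (2 * n). Z $$ (i, l) * Lambda1 n $$ (l, j))"
    using assms by (simp add: scalar_prod_def lessThan_atLeast0 del: sum.lessThan_Suc sum.op_ivl_Suc)
  also have "\<dots> = (\<Sum>l<Suc (2 * n). if l = swap_ends n j then end_sign n j * Z $$ (i, l) else 0)"
    using assms by (intro sum.cong) (auto simp: Lambda1_index)
  also have "\<dots> = end_sign n j * Z $$ (i, swap_ends n j)"
    using assms by (simp del: sum.lessThan_Suc)
  finally show ?thesis .
qed

lemma Lambda1_involution:
  assumes "0 < n"
  shows "Lambda1 n * Lambda1 n = 1\<^sub>m (Suc (2 * n))"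
  by (rule eq_matI)
    (use assms in \<open>auto simp: index_Lambda1_mult[of _ _ "Suc (2 * n)"] Lambda1_index
      simp del: index_mult_mat(1)\<close>)

lemma Lambda1_transpose:
  assumes "0 < n"
  shows "transpose_mat (Lambda1 n) = Lambda1 n"
  by (rule eq_matI) (use assms in \<open>auto simp: Lambda1_index\<close>)

text \<open>The permutation commutes with the reversal of \<open>0, ..., 2n\<close>, and the signs
  are invariant under it. Hence \<open>Lambda1\<close>, being symmetric and its own inverse, is
  orthogonal for \<open>J\<close>.\<close>

lemma Lambda1_reversal_commute:
  assumes "0 < n"
  shows "Lambda1 n * reversal_mat (Suc (2 * n)) = reversal_mat (Suc (2 * n)) * Lambda1 n"
proof (rule eq_matI)
  fix i j
  assume "i < dim_row (reversal_mat (Suc (2 * n)) * Lambda1 n)"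
    and "j < dim_col (reversal_mat (Suc (2 * n)) * Lambda1 n)"
  then have ij: "i < Suc (2 * n)" "j < Suc (2 * n)" by simp_all
  have "2 * n - j = swap_ends n i \<longleftrightarrow> j = 2 * n - swap_ends n i"
    using ij swap_ends_less[OF ij(1)] by linarith
  then show "(Lambda1 n * reversal_mat (Suc (2 * n))) $$ (i, j) =
      (reversal_mat (Suc (2 * n)) * Lambda1 n) $$ (i, j)"
    using ij assms
    by (simp add: index_mult_reversal_mat[of _ "Suc (2 * n)"] Lambda1_index swap_ends_reverse
        index_reversal_mat_mult[of _ _ "Suc (2 * n)"] end_sign_reverse del: index_mult_mat(1))
qed simp_all

text \<open>\<open>theta\<close> is defined through an optional inverse. \<open>Lambda1\<close> is
  an involution, hence a unit, which excludes \<open>None\<close>; uniqueness of inverses identifies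
  the value.\<close>

lemma mat_inverse_Lambda1:
  assumes "0 < n"
  shows "mat_inverse (Lambda1 n) = Some (Lambda1 n)"
proof (cases "mat_inverse (Lambda1 n)")
  case None
  have "Lambda1 n \<in> Units (ring_mat TYPE(complex) (Suc (2 * n)) ())"
    using Lambda1_involution[OF assms] by (auto simp: Units_def ring_mat_simps)
  with mat_inverse(1)[OF Lambda1_carrier None, where b = "()"] show ?thesis by blast
next
  case (Some B)
  from mat_inverse(2)[OF Lambda1_carrier Some]
  have B: "B * Lambda1 n = 1\<^sub>m (Suc (2 * n))" "B \<in> carrier_mat (Suc (2 * n)) (Suc (2 * n))"
    by simp_all
  have "B = B * Lambda1 n * Lambda1 n"
    using B(2) by (simp add: assoc_mult_mat_dim Lambda1_involution[OF assms])
  then show ?thesis using B(1) Some by simp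
qed

lemma theta_eq:
  assumes "0 < n"
  shows "theta n Z = Lambda1 n * Z * Lambda1 n"
  by (simp add: theta_def mat_inverse_Lambda1[OF assms])

lemma theta_carrier [simp]:
  "0 < n \<Longrightarrow> Z \<in> carrier_mat (Suc (2 * n)) (Suc (2 * n)) \<Longrightarrow>
     theta n Z \<in> carrier_mat (Suc (2 * n)) (Suc (2 * n))"
  by (auto simp: theta_eq)

lemma theta_index:
  assumes "0 < n" "Z \<in> carrier_mat (Suc (2 * n)) (Suc (2 * n))" "i < Suc (2 * n)" "j < Suc (2 * n)"
  shows "theta n Z $$ (i, j) = end_sign n i * end_sign n j * Z $$ (swap_ends n i, swap_ends n j)"
  using assms
  by (simp add: theta_eq index_mult_Lambda1[of _ _ "Suc (2 * n)"] index_Lambda1_mult[of _ _ "Suc (2 * n)"]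
      mult_carrier_mat[of _ "Suc (2 * n)" "Suc (2 * n)"] del: index_mult_mat(1))

text \<open>Because \<open>Lambda1\<close> is symmetric and commutes with \<open>J\<close>,
  conjugation by it commutes with taking the adjoint.\<close>

lemma theta_so_rev:
  assumes "0 < n" "Z \<in> so_rev (Suc (2 * n))"
  shows "theta n Z \<in> so_rev (Suc (2 * n))"
proof -
  let ?J = "reversal_mat (Suc (2 * n))" and ?S = "Lambda1 n"
  have Z: "Z \<in> carrier_mat (Suc (2 * n)) (Suc (2 * n))" using assms(2) by (simp add: so_rev_def)
  have "?J * transpose_mat (theta n Z) * ?J = (?J * ?S) * transpose_mat Z * (?S * ?J)"
    using Z assms(1) by (simp add: theta_eq transpose_mult_dim assoc_mult_mat_dim Lambda1_transpose)
  also have "\<dots> = (?S * ?J) * transpose_mat Z * (?J * ?S)"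
    by (simp only: Lambda1_reversal_commute[OF assms(1)])
  also have "\<dots> = ?S * (?J * transpose_mat Z * ?J) * ?S"
    using Z by (simp add: assoc_mult_mat_dim)
  also have "\<dots> = - theta n Z"
    using Z assms by (simp add: so_rev_conj_transpose theta_eq)
  finally show ?thesis using Z assms(1) by (simp add: so_rev_iff_conj_transpose)
qed

lemma theta_involution:
  assumes "0 < n" "Z \<in> carrier_mat (Suc (2 * n)) (Suc (2 * n))"
  shows "theta n (theta n Z) = Z"
proof -
  have "theta n (theta n Z) = (Lambda1 n * Lambda1 n) * Z * (Lambda1 n * Lambda1 n)"
    using assms by (simp add: theta_eq assoc_mult_mat_dim)
  then show ?thesis using assms by (simp add: Lambda1_involution)
qed

text \<open>The instance \<open>A = B = Lambda1\<close> of \<open>lie_isomorphismI_mult\<close>, in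
  which \<open>B A = 1\<close>.\<close>

lemma theta_lie_isomorphism:
  assumes "0 < n"
  shows "lie_isomorphism (2 * n + 1) (g_alg n) (2 * n + 1) (g_alg n) (theta n)"
proof -
  have "lie_isomorphism (Suc (2 * n)) (so_rev (Suc (2 * n))) (Suc (2 * n)) (so_rev (Suc (2 * n)))
      (\<lambda>X. Lambda1 n * X * Lambda1 n)"
  proof (rule lie_isomorphismI_mult)
    fix X assume X: "X \<in> so_rev (Suc (2 * n))"
    then have "X \<in> carrier_mat (Suc (2 * n)) (Suc (2 * n))" by (simp add: so_rev_def)
    then show "X * (Lambda1 n * Lambda1 n) = X" "Lambda1 n * Lambda1 n * X = X"
      by (simp_all add: Lambda1_involution[OF assms])
    show "Lambda1 n * X * Lambda1 n \<in> so_rev (Suc (2 * n))"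
      using theta_so_rev[OF assms X] by (simp add: theta_eq[OF assms])
    then show "Lambda1 n * X * Lambda1 n \<in> so_rev (Suc (2 * n))" .
  qed (simp_all add: so_rev_lie_algebra Lambda1_involution[OF assms])
  moreover have "theta n = (\<lambda>X. Lambda1 n * X * Lambda1 n)"
    by (rule ext) (rule theta_eq[OF assms])
  ultimately show ?thesis by (simp add: g_alg_eq_so_rev)
qed

section \<open>Splitting into the eigenspaces of the involution\<close>

lemma internal_direct_sumI:
  assumes S: "mat_subspace N S" and A: "mat_subspace N A" and B: "mat_subspace N B"
    and sub: "A \<subseteq> S" "B \<subseteq> S"
    and decomp: "\<And>Z. Z \<in> S \<Longrightarrow> \<exists>X\<in>A. \<exists>Y\<in>B. Z = X + Y"
    and trivial: "\<And>Z. Z \<in> A \<Longrightarrow> Z \<in> B \<Longrightarrow> Z = 0\<^sub>m N N"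
  shows "internal_direct_sum N S A B"
proof -
  interpret vectorspace "class_ring :: complex ring" "mat_space N" by (rule matrix_vs)
  have "S = submodule_sum A B"
  proof
    show "S \<subseteq> submodule_sum A B"
    proof
      fix Z assume "Z \<in> S"
      then obtain X Y where "X \<in> A" "Y \<in> B" "Z = X + Y" using decomp by blast
      then show "Z \<in> submodule_sum A B"
        unfolding submodule_sum_def
        by (intro image_eqI[of _ _ "(X, Y)"]) (simp_all add: module_mat_simps)
    qed
    show "submodule_sum A B \<subseteq> S"
    proof
      fix Z assume "Z \<in> submodule_sum A B"
      then obtain X Y where XY: "X \<in> A" "Y \<in> B" and Z: "Z = X + Y"
        by (auto simp: submodule_sum_def module_mat_simps)
      show "Z \<in> S" unfolding Z using XY sub by (intro mat_subspaceD(3)[OF S]) blast+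
    qed
  qed
  moreover have "A \<inter> B = {0\<^sub>m N N}"
    using trivial mat_subspaceD(2)[OF A] mat_subspaceD(2)[OF B] by blast
  ultimately show ?thesis using S A B by (simp add: internal_direct_sum_def)
qed

lemma eq_uminus_self_complex: "(z :: complex) = - z \<Longrightarrow> z = 0"
  by (simp add: complex_eq_iff)

lemma theta_add:
  assumes "0 < n" "X \<in> carrier_mat (Suc (2 * n)) (Suc (2 * n))" "Y \<in> carrier_mat (Suc (2 * n)) (Suc (2 * n))"
  shows "theta n (X + Y) = theta n X + theta n Y"
  using assms mult_carrier_mat[OF Lambda1_carrier assms(2)] mult_carrier_mat[OF Lambda1_carrier assms(3)]
  by (simp add: theta_eq mult_add_distrib_mat[of _ "Suc (2 * n)" "Suc (2 * n)" _ "Suc (2 * n)"]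
      add_mult_distrib_mat[of _ "Suc (2 * n)" "Suc (2 * n)" _ _ "Suc (2 * n)"])

lemma theta_smult:
  assumes "0 < n" "X \<in> carrier_mat (Suc (2 * n)) (Suc (2 * n))"
  shows "theta n (c \<cdot>\<^sub>m X) = c \<cdot>\<^sub>m theta n X"
  using assms mult_carrier_mat[OF Lambda1_carrier assms(2)]
  by (simp add: theta_eq mult_smult_distrib[of _ "Suc (2 * n)" "Suc (2 * n)" _ "Suc (2 * n)"]
      mult_smult_assoc_mat[of _ "Suc (2 * n)" "Suc (2 * n)" _ "Suc (2 * n)"])

lemma so_rev_subspace: "mat_subspace m (so_rev m)"
  using so_rev_lie_algebra[of m] by (simp add: mat_lie_algebra_def)

lemma so_rev_carrier: "Z \<in> so_rev m \<Longrightarrow> Z \<in> carrier_mat m m"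
  by (simp add: so_rev_def)

lemma g0_iff: "Z \<in> g0 n \<longleftrightarrow> Z \<in> so_rev (Suc (2 * n)) \<and> theta n Z = Z"
  and g1_iff: "Z \<in> g1 n \<longleftrightarrow> Z \<in> so_rev (Suc (2 * n)) \<and> theta n Z = - Z"
  by (simp_all add: g0_def g1_def g_alg_eq_so_rev)

lemma g0_carrier: "Z \<in> g0 n \<Longrightarrow> Z \<in> carrier_mat (Suc (2 * n)) (Suc (2 * n))"
  and g1_carrier: "Z \<in> g1 n \<Longrightarrow> Z \<in> carrier_mat (Suc (2 * n)) (Suc (2 * n))"
  by (simp_all add: g0_iff g1_iff so_rev_carrier)

lemma g0_subspace:
  assumes "0 < n"
  shows "mat_subspace (Suc (2 * n)) (g0 n)"
proof (rule mat_subspaceI)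
  show "0\<^sub>m (Suc (2 * n)) (Suc (2 * n)) \<in> g0 n"
    using mat_subspaceD(2)[OF so_rev_subspace, of "Suc (2 * n)"]
    by (simp add: g0_iff theta_eq[OF assms])
qed (use assms in \<open>auto simp: g0_iff so_rev_carrier theta_add theta_smult
  mat_subspaceD(3,4)[OF so_rev_subspace]\<close>)

lemma g1_subspace:
  assumes "0 < n"
  shows "mat_subspace (Suc (2 * n)) (g1 n)"
proof (rule mat_subspaceI)
  have "- 0\<^sub>m (Suc (2 * n)) (Suc (2 * n)) = (0\<^sub>m (Suc (2 * n)) (Suc (2 * n)) :: complex mat)"
    by (rule eq_matI) auto
  then show "0\<^sub>m (Suc (2 * n)) (Suc (2 * n)) \<in> g1 n"
    using mat_subspaceD(2)[OF so_rev_subspace, of "Suc (2 * n)"]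
    by (simp add: g1_iff theta_eq[OF assms])
next
  fix X Y assume XY: "X \<in> g1 n" "Y \<in> g1 n"
  note c = g1_carrier[OF XY(1)] g1_carrier[OF XY(2)]
  have "theta n (X + Y) = - X + - Y" using XY by (simp add: theta_add[OF assms c] g1_iff)
  also have "\<dots> = - (X + Y)" using c by (intro eq_matI) auto
  finally show "X + Y \<in> g1 n" using XY by (simp add: g1_iff mat_subspaceD(3)[OF so_rev_subspace])
next
  fix k X assume X: "X \<in> g1 n"
  note c = g1_carrier[OF X]
  have "theta n (k \<cdot>\<^sub>m X) = k \<cdot>\<^sub>m - X" using X by (simp add: theta_smult[OF assms c] g1_iff)
  also have "\<dots> = - (k \<cdot>\<^sub>m X)" using c by (intro eq_matI) auto
  finally show "k \<cdot>\<^sub>m X \<in> g1 n" using X by (simp add: g1_iff mat_subspaceD(4)[OF so_rev_subspace])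
qed (auto simp: g1_carrier)

lemma g_alg_direct_sum:
  assumes "0 < n"
  shows "internal_direct_sum (Suc (2 * n)) (g_alg n) (g0 n) (g1 n)"
proof (rule internal_direct_sumI)
  let ?N = "Suc (2 * n)"
  show "mat_subspace ?N (g_alg n)" by (simp add: g_alg_eq_so_rev so_rev_subspace)
  show "mat_subspace ?N (g0 n)" "mat_subspace ?N (g1 n)"
    using assms by (simp_all add: g0_subspace g1_subspace)
  show "g0 n \<subseteq> g_alg n" "g1 n \<subseteq> g_alg n" by (auto simp: g0_def g1_def)
  show "\<exists>X\<in>g0 n. \<exists>Y\<in>g1 n. Z = X + Y" if "Z \<in> g_alg n" for Z
  proof (intro bexI)
    \<comment> \<open>Half the sum and half the difference are the two eigenprojections of an
      involution.\<close>
    let ?X = "(1 / 2) \<cdot>\<^sub>m (Z + theta n Z)" and ?Y = "(1 / 2) \<cdot>\<^sub>m (Z + (- 1) \<cdot>\<^sub>m theta n Z)"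
    have Z: "Z \<in> so_rev ?N" "Z \<in> carrier_mat ?N ?N"
      using that by (simp_all add: g_alg_eq_so_rev so_rev_carrier)
    have T: "theta n Z \<in> so_rev ?N" "theta n Z \<in> carrier_mat ?N ?N"
      using theta_so_rev[OF assms Z(1)] by (simp_all add: so_rev_carrier)
    have "theta n ?X = (1 / 2) \<cdot>\<^sub>m (theta n Z + Z)"
      using Z(2) T(2) by (simp add: theta_smult[OF assms] theta_add[OF assms] theta_involution[OF assms])
    also have "\<dots> = ?X" by (simp only: comm_add_mat[OF T(2) Z(2)])
    finally show "?X \<in> g0 n"
      using Z T mat_subspaceD(3,4)[OF so_rev_subspace] by (simp add: g0_iff)
    have "theta n ?Y = (1 / 2) \<cdot>\<^sub>m (theta n Z + (- 1) \<cdot>\<^sub>m Z)"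
      using Z(2) T(2) by (simp add: theta_smult[OF assms] theta_add[OF assms] theta_involution[OF assms])
    also have "\<dots> = - ?Y" using Z(2) T(2) by (intro eq_matI) (simp_all add: field_simps)
    finally show "?Y \<in> g1 n"
      using Z T mat_subspaceD(3,4)[OF so_rev_subspace] by (simp add: g1_iff)
    have "1 / 2 * (a + b) + 1 / 2 * (a - b) = a" for a b :: complex by (simp add: field_simps)
    then show "Z = ?X + ?Y" using Z(2) T(2) by (intro eq_matI) simp_all
  qed
  show "Z = 0\<^sub>m ?N ?N" if "Z \<in> g0 n" "Z \<in> g1 n" for Z
  proof (rule eq_matI)
    have "Z = - Z" using that unfolding g0_iff g1_iff by metis
    then have "Z $$ (i, j) = (- Z) $$ (i, j)" for i j by (rule arg_cong)
    then have "Z $$ (i, j) = 0" if "i < ?N" "j < ?N" for i j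
      using that g0_carrier[OF \<open>Z \<in> g0 n\<close>]
      by (intro eq_uminus_self_complex) (metis index_uminus_mat(1) carrier_matD)
    then show "Z $$ (i, j) = 0\<^sub>m ?N ?N $$ (i, j)"
      if "i < dim_row (0\<^sub>m ?N ?N :: complex mat)" "j < dim_col (0\<^sub>m ?N ?N :: complex mat)" for i j
      using that by simp
  qed (use g0_carrier[OF that(1)] in auto)
qed

lemma so_rev_odd_index:
  assumes "Z \<in> so_rev (Suc (2 * n))" "i \<le> 2 * n" "j \<le> 2 * n"
  shows "Z $$ (i, j) = - Z $$ (2 * n - j, 2 * n - i)"
  using so_rev_index[OF assms(1), of i j] assms(2,3) by simp

text \<open>Two symmetries act on the entries: reflection in the anti-diagonal with a sign, and
  \<open>theta\<close>. The corners \<open>(0, 2n)\<close> and \<open>(2n, 0)\<close> are their own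
  reflections, so they vanish. The other two corners are equal by \<open>theta\<close> and opposite
  by reflection, so they vanish too. The rest of the border is determined by the first
  column.\<close>

lemma g0_entries:
  assumes "0 < n" "Z \<in> g0 n"
  shows "Z $$ (0, 0) = 0" "Z $$ (0, 2 * n) = 0" "Z $$ (2 * n, 0) = 0" "Z $$ (2 * n, 2 * n) = 0"
    and "0 < i \<Longrightarrow> i < 2 * n \<Longrightarrow> Z $$ (i, 2 * n) = - Z $$ (i, 0)"
    and "0 < i \<Longrightarrow> i < 2 * n \<Longrightarrow> Z $$ (0, i) = Z $$ (2 * n - i, 0)"
    and "0 < i \<Longrightarrow> i < 2 * n \<Longrightarrow> Z $$ (2 * n, i) = - Z $$ (2 * n - i, 0)"
proof -
  have so: "Z \<in> so_rev (Suc (2 * n))" using assms by (simp add: g0_iff)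
  note refl = so_rev_odd_index[OF so]
  have eig: "end_sign n i * end_sign n j * Z $$ (swap_ends n i, swap_ends n j) = Z $$ (i, j)"
    if "i \<le> 2 * n" "j \<le> 2 * n" for i j
    using theta_index[OF assms(1) g0_carrier[OF assms(2)], of i j] assms(2) that by (simp add: g0_iff)
  have corners: "Z $$ (0, 2 * n) = - Z $$ (0, 2 * n)" "Z $$ (2 * n, 0) = - Z $$ (2 * n, 0)"
    using refl[of 0 "2 * n"] refl[of "2 * n" 0] unfolding diff_self_eq_0 diff_zero by blast+
  show "Z $$ (0, 2 * n) = 0" "Z $$ (2 * n, 0) = 0"
    by (rule eq_uminus_self_complex[OF corners(1)], rule eq_uminus_self_complex[OF corners(2)])
  have corner: "Z $$ (2 * n, 2 * n) = Z $$ (0, 0)" using eig[of 0 0] by simp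
  moreover have "Z $$ (0, 0) = - Z $$ (2 * n, 2 * n)"
    using refl[of 0 0] unfolding diff_zero by blast
  ultimately show "Z $$ (0, 0) = 0" by (intro eq_uminus_self_complex) simp
  with corner show "Z $$ (2 * n, 2 * n) = 0" by simp
  show col: "Z $$ (i, 2 * n) = - Z $$ (i, 0)" if "0 < i" "i < 2 * n" for i
    using eig[of i "2 * n"] that by (simp add: middle_simps)
  show "Z $$ (0, i) = Z $$ (2 * n - i, 0)" "Z $$ (2 * n, i) = - Z $$ (2 * n - i, 0)"
    if "0 < i" "i < 2 * n"
    using refl[of 0 i] refl[of "2 * n" i] col[of "2 * n - i"] that by simp_all
qed

text \<open>The same two symmetries with the sign of \<open>theta\<close> reversed. Both now make
  \<open>(0, 0)\<close> and \<open>(2n, 2n)\<close> opposite, so this corner stays free, whereas the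
  middle block, which \<open>theta\<close> fixes, must vanish.\<close>

lemma g1_entries:
  assumes "0 < n" "Z \<in> g1 n"
  shows "Z $$ (0, 2 * n) = 0" "Z $$ (2 * n, 0) = 0" "Z $$ (2 * n, 2 * n) = - Z $$ (0, 0)"
    and "0 < i \<Longrightarrow> i < 2 * n \<Longrightarrow> 0 < j \<Longrightarrow> j < 2 * n \<Longrightarrow> Z $$ (i, j) = 0"
    and "0 < i \<Longrightarrow> i < 2 * n \<Longrightarrow> Z $$ (i, 2 * n) = Z $$ (i, 0)"
    and "0 < i \<Longrightarrow> i < 2 * n \<Longrightarrow> Z $$ (0, i) = - Z $$ (2 * n - i, 0)"
    and "0 < i \<Longrightarrow> i < 2 * n \<Longrightarrow> Z $$ (2 * n, i) = - Z $$ (2 * n - i, 0)"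
proof -
  have so: "Z \<in> so_rev (Suc (2 * n))" using assms by (simp add: g1_iff)
  note refl = so_rev_odd_index[OF so]
  have eig: "end_sign n i * end_sign n j * Z $$ (swap_ends n i, swap_ends n j) = - Z $$ (i, j)"
    if "i \<le> 2 * n" "j \<le> 2 * n" for i j
    using theta_index[OF assms(1) g1_carrier[OF assms(2)], of i j] assms(2) that
      g1_carrier[OF assms(2)] by (simp add: g1_iff)
  have corners: "Z $$ (0, 2 * n) = - Z $$ (0, 2 * n)" "Z $$ (2 * n, 0) = - Z $$ (2 * n, 0)"
    using refl[of 0 "2 * n"] refl[of "2 * n" 0] unfolding diff_self_eq_0 diff_zero by blast+
  show "Z $$ (0, 2 * n) = 0" "Z $$ (2 * n, 0) = 0"
    by (rule eq_uminus_self_complex[OF corners(1)], rule eq_uminus_self_complex[OF corners(2)])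
  show "Z $$ (2 * n, 2 * n) = - Z $$ (0, 0)" using eig[of 0 0] by simp
  show "Z $$ (i, j) = 0" if "0 < i" "i < 2 * n" "0 < j" "j < 2 * n"
    using eig[of i j] that by (simp add: middle_simps)
  show col: "Z $$ (i, 2 * n) = Z $$ (i, 0)" if "0 < i" "i < 2 * n" for i
    using eig[of i "2 * n"] that by (simp add: middle_simps)
  show "Z $$ (0, i) = - Z $$ (2 * n - i, 0)" "Z $$ (2 * n, i) = - Z $$ (2 * n - i, 0)"
    if "0 < i" "i < 2 * n"
    using refl[of 0 i] refl[of "2 * n" i] col[of "2 * n - i"] that by simp_all
qed

section \<open>The middle block\<close>

lemma lie_bracket_index_zero:
  assumes "X \<in> carrier_mat m m" "Y \<in> carrier_mat m m" "i < m" "j < m"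
    and "\<And>k. k < m \<Longrightarrow> X $$ (i, k) = 0 \<or> Y $$ (k, j) = 0"
    and "\<And>k. k < m \<Longrightarrow> Y $$ (i, k) = 0 \<or> X $$ (k, j) = 0"
  shows "lie_bracket X Y $$ (i, j) = 0"
proof -
  have "(\<Sum>k = 0..<m. X $$ (i, k) * Y $$ (k, j)) = 0" "(\<Sum>k = 0..<m. Y $$ (i, k) * X $$ (k, j)) = 0"
    by (rule sum.neutral; use assms(5,6) in auto)+
  then show ?thesis using assms(1-4) by (simp add: lie_bracket_def scalar_prod_def)
qed

definition middle_restriction :: "nat \<Rightarrow> complex mat" where
  "middle_restriction n = mat (2 * n - 1) (Suc (2 * n)) (\<lambda>(i, j). if j = Suc i then 1 else 0)"

lemma middle_restriction_carrier [simp]: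
    "middle_restriction n \<in> carrier_mat (2 * n - 1) (Suc (2 * n))"
  and middle_restriction_dim [simp]:
    "dim_row (middle_restriction n) = 2 * n - 1" "dim_col (middle_restriction n) = Suc (2 * n)"
  by (simp_all add: middle_restriction_def)

lemma index_mult_middle_restriction_transpose:
  assumes "Z \<in> carrier_mat k (Suc (2 * n))" "i < k" "j < 2 * n - 1"
  shows "(Z * transpose_mat (middle_restriction n)) $$ (i, j) = Z $$ (i, Suc j)"
proof -
  have "(Z * transpose_mat (middle_restriction n)) $$ (i, j) =
      (\<Sum>l<Suc (2 * n). Z $$ (i, l) * (if l = Suc j then 1 else 0))"
    using assms
    by (simp add: middle_restriction_def scalar_prod_def lessThan_atLeast0
        del: sum.lessThan_Suc sum.op_ivl_Suc)
  also have "\<dots> = (\<Sum>l<Suc (2 * n). if l = Suc j then Z $$ (i, l) else 0)"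
    by (intro sum.cong) auto
  also have "\<dots> = Z $$ (i, Suc j)" using assms by (simp del: sum.lessThan_Suc)
  finally show ?thesis .
qed

lemma index_mult_middle_restriction:
  assumes "Z \<in> carrier_mat k (2 * n - 1)" "i < k" "j < Suc (2 * n)"
  shows "(Z * middle_restriction n) $$ (i, j) = (if 0 < j \<and> j < 2 * n then Z $$ (i, j - 1) else 0)"
proof -
  have "(Z * middle_restriction n) $$ (i, j) =
      (\<Sum>l<2 * n - 1. Z $$ (i, l) * (if j = Suc l then 1 else 0))"
    using assms by (simp add: middle_restriction_def scalar_prod_def lessThan_atLeast0)
  \<comment> \<open>At \<open>j = 0\<close> truncated subtraction would select \<open>l = 0\<close>,
    hence the inner test; at \<open>j = 2n\<close> the index \<open>j - 1\<close> lies outside the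
    sum.\<close>
  also have "\<dots> = (\<Sum>l<2 * n - 1. if l = j - 1 then (if 0 < j then Z $$ (i, l) else 0) else 0)"
    by (intro sum.cong) auto
  also have "\<dots> = (if 0 < j \<and> j < 2 * n then Z $$ (i, j - 1) else 0)" using assms by auto
  finally show ?thesis .
qed

definition middle_proj :: "nat \<Rightarrow> complex mat" where
  "middle_proj n = mat (Suc (2 * n)) (Suc (2 * n)) (\<lambda>(i, j). if i = j \<and> 0 < i \<and> i < 2 * n then 1 else 0)"

lemma middle_restriction_coisometry:
  "middle_restriction n * transpose_mat (middle_restriction n) = 1\<^sub>m (2 * n - 1)"
proof (rule eq_matI)
  fix i j assume "i < dim_row (1\<^sub>m (2 * n - 1) :: complex mat)" "j < dim_col (1\<^sub>m (2 * n - 1) :: complex mat)"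
  then have ij: "i < 2 * n - 1" "j < 2 * n - 1" by simp_all
  show "(middle_restriction n * transpose_mat (middle_restriction n)) $$ (i, j) = 1\<^sub>m (2 * n - 1) $$ (i, j)"
    unfolding index_mult_middle_restriction_transpose[OF middle_restriction_carrier ij]
    using ij by (simp add: middle_restriction_def)
qed simp_all

lemma middle_restriction_projection:
  "transpose_mat (middle_restriction n) * middle_restriction n = middle_proj n"
proof (rule eq_matI)
  fix i j assume "i < dim_row (middle_proj n)" "j < dim_col (middle_proj n)"
  then have ij: "i < Suc (2 * n)" "j < Suc (2 * n)" by (simp_all add: middle_proj_def)
  have "j - 1 < 2 * n - 1" "i = Suc (j - 1) \<longleftrightarrow> i = j" if "0 < j" "j < 2 * n" using that by auto
  then show "(transpose_mat (middle_restriction n) * middle_restriction n) $$ (i, j) = middle_proj n $$ (i, j)"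
    unfolding index_mult_middle_restriction[OF transpose_carrier_mat[THEN iffD2, OF middle_restriction_carrier] ij]
    using ij by (simp add: middle_restriction_def middle_proj_def)
qed (simp_all add: middle_proj_def)

text \<open>The reversal of \<open>0, ..., 2n\<close> maps the middle indices to themselves in
  reversed order. This is what allows the smaller \<open>P\<close> to follow the
  restriction.\<close>

lemma middle_restriction_reversal:
  "reversal_mat (Suc (2 * n)) * transpose_mat (middle_restriction n) =
     transpose_mat (middle_restriction n) * reversal_mat (2 * n - 1)"
proof (rule eq_matI)
  fix i j
  assume "i < dim_row (transpose_mat (middle_restriction n) * reversal_mat (2 * n - 1))"
    "j < dim_col (transpose_mat (middle_restriction n) * reversal_mat (2 * n - 1))"
  then have ij: "i < Suc (2 * n)" "j < 2 * n - 1" by simp_all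
  have T: "transpose_mat (middle_restriction n) \<in> carrier_mat (Suc (2 * n)) (2 * n - 1)"
    using transpose_carrier_mat[of "middle_restriction n"] middle_restriction_carrier by blast
  from ij have "2 * n - i = Suc j \<longleftrightarrow> i = Suc (2 * n - 1 - 1 - j)" by linarith
  then show "(reversal_mat (Suc (2 * n)) * transpose_mat (middle_restriction n)) $$ (i, j) =
      (transpose_mat (middle_restriction n) * reversal_mat (2 * n - 1)) $$ (i, j)"
    unfolding index_mult_reversal_mat[OF T ij] index_reversal_mat_mult[OF T ij]
    using ij by (simp add: middle_restriction_def)
qed simp_all

definition middle_frame :: "nat \<Rightarrow> complex mat" where
  "middle_frame n = reversal_root (2 * n - 1) * middle_restriction n"

lemma reversal_root_dim [simp]: "dim_row (reversal_root m) = m" "dim_col (reversal_root m) = m"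
  using carrier_matD[OF reversal_root_carrier] by blast+

lemma middle_frame_carrier [simp]: "middle_frame n \<in> carrier_mat (2 * n - 1) (Suc (2 * n))"
  by (auto simp: middle_frame_def)

lemma middle_frame_orthonormal:
  "middle_frame n * (reversal_mat (Suc (2 * n)) * transpose_mat (middle_frame n)) = 1\<^sub>m (2 * n - 1)"
proof -
  let ?R = "middle_restriction n" and ?P = "reversal_root (2 * n - 1)"
  have "middle_frame n * (reversal_mat (Suc (2 * n)) * transpose_mat (middle_frame n)) =
      ?P * ?R * ((reversal_mat (Suc (2 * n)) * transpose_mat ?R) * ?P)"
    by (simp add: middle_frame_def transpose_mult_dim assoc_mult_mat_dim)
  also have "\<dots> = ?P * ((?R * transpose_mat ?R) * (reversal_mat (2 * n - 1) * ?P))"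
    unfolding middle_restriction_reversal by (simp add: assoc_mult_mat_dim)
  also have "\<dots> = 1\<^sub>m (2 * n - 1)"
    unfolding middle_restriction_coisometry by simp
  finally show ?thesis .
qed

text \<open>Moving \<open>J\<close> past the transposed restriction produces the smaller
  \<open>J\<close>, which cancels against \<open>P\<^sup>2\<close>.\<close>

lemma middle_frame_projection:
  "reversal_mat (Suc (2 * n)) * transpose_mat (middle_frame n) * middle_frame n = middle_proj n"
proof -
  let ?R = "middle_restriction n" and ?P = "reversal_root (2 * n - 1)"
  have "reversal_mat (Suc (2 * n)) * transpose_mat (middle_frame n) * middle_frame n =
      (reversal_mat (Suc (2 * n)) * transpose_mat ?R) * ((?P * ?P) * ?R)"
    by (simp add: middle_frame_def transpose_mult_dim assoc_mult_mat_dim del: reversal_root_square)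
  also have "\<dots> = transpose_mat ?R * ?R"
    unfolding middle_restriction_reversal by (simp add: assoc_mult_mat_dim)
  finally show ?thesis by (simp add: middle_restriction_projection)
qed

lemma index_mult_middle_proj:
  assumes "Z \<in> carrier_mat k (Suc (2 * n))" "i < k" "j < Suc (2 * n)"
  shows "(Z * middle_proj n) $$ (i, j) = (if 0 < j \<and> j < 2 * n then Z $$ (i, j) else 0)"
proof -
  have "(Z * middle_proj n) $$ (i, j) =
      (\<Sum>l<Suc (2 * n). Z $$ (i, l) * (if l = j \<and> 0 < l \<and> l < 2 * n then 1 else 0))"
    using assms
    by (simp add: middle_proj_def scalar_prod_def lessThan_atLeast0 del: sum.lessThan_Suc sum.op_ivl_Suc)
  also have "\<dots> = (\<Sum>l<Suc (2 * n). if l = j then (if 0 < l \<and> l < 2 * n then Z $$ (i, l) else 0) else 0)"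
    by (intro sum.cong) auto
  also have "\<dots> = (if 0 < j \<and> j < 2 * n then Z $$ (i, j) else 0)"
    using assms by (simp del: sum.lessThan_Suc)
  finally show ?thesis .
qed

lemma g0_tilde_iff:
  "Z \<in> g0_tilde n \<longleftrightarrow> Z \<in> so_rev (Suc (2 * n)) \<and>
     (\<forall>i\<le>2 * n. \<forall>j\<le>2 * n. i \<in> {0, 2 * n} \<or> j \<in> {0, 2 * n} \<longrightarrow> Z $$ (i, j) = 0)"
  by (simp add: g0_tilde_def g_alg_eq_so_rev)

text \<open>Right multiplication by \<open>middle_proj\<close> tests only the first and last
  columns; reflection in the anti-diagonal carries their vanishing over to the first and last
  rows.\<close>

lemma g0_tilde_eq_compression:
  "g0_tilde n = {Z \<in> so_rev (Suc (2 * n)).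
     Z * (reversal_mat (Suc (2 * n)) * transpose_mat (middle_frame n) * middle_frame n) = Z}"
proof (intro Set.set_eqI)
  fix Z
  have "Z * middle_proj n = Z \<longleftrightarrow>
      (\<forall>i\<le>2 * n. \<forall>j\<le>2 * n. i \<in> {0, 2 * n} \<or> j \<in> {0, 2 * n} \<longrightarrow> Z $$ (i, j) = 0)"
    if so: "Z \<in> so_rev (Suc (2 * n))"
  proof -
    have Z: "Z \<in> carrier_mat (Suc (2 * n)) (Suc (2 * n))" using so by (rule so_rev_carrier)
    have "\<forall>i\<le>2 * n. \<forall>j\<le>2 * n. i \<in> {0, 2 * n} \<or> j \<in> {0, 2 * n} \<longrightarrow> Z $$ (i, j) = 0"
      if fixed: "Z * middle_proj n = Z"
    proof -
      have col: "Z $$ (i, j) = 0" if "i \<le> 2 * n" "j = 0 \<or> j = 2 * n" for i j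
        using index_mult_middle_proj[OF Z, of i j] that unfolding fixed by auto
      have row: "Z $$ (i, j) = 0" if "j \<le> 2 * n" "i = 0 \<or> i = 2 * n" for i j
      proof -
        have "2 * n - i = 0 \<or> 2 * n - i = 2 * n" using that by auto
        then have "Z $$ (2 * n - j, 2 * n - i) = 0" by (intro col) simp_all
        then show ?thesis using so_rev_odd_index[OF so, of i j] that by auto
      qed
      show ?thesis using col row by blast
    qed
    moreover have "Z * middle_proj n = Z"
      if border: "\<forall>i\<le>2 * n. \<forall>j\<le>2 * n. i \<in> {0, 2 * n} \<or> j \<in> {0, 2 * n} \<longrightarrow> Z $$ (i, j) = 0"
    proof (rule eq_matI)
        fix i j assume "i < dim_row Z" "j < dim_col Z"
        then have ij: "i < Suc (2 * n)" "j < Suc (2 * n)" using Z by simp_all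
        show "(Z * middle_proj n) $$ (i, j) = Z $$ (i, j)"
        proof (cases "0 < j \<and> j < 2 * n")
          case True
          then show ?thesis unfolding index_mult_middle_proj[OF Z ij] by (rule if_P)
        next
          case False
          then have "j \<in> {0, 2 * n}" using ij by auto
          moreover have "i \<le> 2 * n" "j \<le> 2 * n" using ij by simp_all
          ultimately have "Z $$ (i, j) = 0" using border by blast
          then show ?thesis using False by (simp only: index_mult_middle_proj[OF Z ij] if_False)
        qed
      qed (use Z in \<open>simp_all add: middle_proj_def\<close>)
    ultimately show ?thesis by blast
  qed
  then show "Z \<in> g0_tilde n \<longleftrightarrow> Z \<in> {Z \<in> so_rev (Suc (2 * n)).
      Z * (reversal_mat (Suc (2 * n)) * transpose_mat (middle_frame n) * middle_frame n) = Z}"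
    unfolding middle_frame_projection g0_tilde_iff by blast
qed

lemma g0_tilde_lie_algebra: "mat_lie_algebra (Suc (2 * n)) (g0_tilde n)"
  using so_rev_compression(1)[OF middle_frame_carrier middle_frame_orthonormal]
  by (simp only: g0_tilde_eq_compression)

lemma g0_tilde_lie_isomorphism:
  "lie_isomorphism (Suc (2 * n)) (g0_tilde n) (2 * n - 1) (so_alg (2 * n - 1))
     (\<lambda>X. middle_frame n * X * (reversal_mat (Suc (2 * n)) * transpose_mat (middle_frame n)))"
  using so_rev_compression(2)[OF middle_frame_carrier middle_frame_orthonormal]
  by (simp only: g0_tilde_eq_compression)

lemma g_alg_lie_isomorphic: "lie_isomorphic (Suc (2 * n)) (g_alg n) (Suc (2 * n)) (so_alg (Suc (2 * n)))"
proof -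
  let ?J = "reversal_mat (Suc (2 * n))" and ?P = "reversal_root (Suc (2 * n))"
  have "?P * (?J * transpose_mat ?P) = 1\<^sub>m (Suc (2 * n))"
    by simp
  \<comment> \<open>Here \<open>J P^T P = J J = 1\<close>, so every \<open>X\<close> satisfies the
    compression condition.\<close>
  moreover have "{X \<in> so_rev (Suc (2 * n)). X * (?J * transpose_mat ?P * ?P) = X} = g_alg n"
    by (auto simp: g_alg_eq_so_rev assoc_mult_mat_dim dest: so_rev_carrier)
  ultimately show ?thesis
    using so_rev_compression(2)[OF reversal_root_carrier, of "Suc (2 * n)"]
    unfolding lie_isomorphic_def by auto
qed

section \<open>The fixed algebra of the involution\<close>

text \<open>The rows of \<open>fold_mat\<close> form an orthonormal basis of the \<open>-1\<close> eigenspace of \<open>Lambda1\<close>: row \<open>0\<close> is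
  \<open>(e\<^sub>0 - e\<^bsub>2n\<^esub>) / \<surd>2\<close> and row \<open>i > 0\<close> is \<open>e\<^sub>i\<close>.\<close>

definition fold_weight :: "nat \<Rightarrow> nat \<Rightarrow> complex" where
  "fold_weight n j = (if j = 0 then 1 / complex_of_real (sqrt 2)
     else if j = 2 * n then - 1 / complex_of_real (sqrt 2) else 1)"

definition fold_mat :: "nat \<Rightarrow> complex mat" where
  "fold_mat n = mat (2 * n) (Suc (2 * n))
     (\<lambda>(i, j). if i = (if j = 2 * n then 0 else j) then fold_weight n j else 0)"

lemma fold_mat_carrier [simp]: "fold_mat n \<in> carrier_mat (2 * n) (Suc (2 * n))"
  and fold_mat_dim [simp]: "dim_row (fold_mat n) = 2 * n" "dim_col (fold_mat n) = Suc (2 * n)"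
  by (simp_all add: fold_mat_def)

lemma complex_sqrt2_square: "complex_of_real (sqrt 2) * complex_of_real (sqrt 2) = 2"
  by (simp flip: of_real_mult)

lemma fold_mat_coisometry:
  assumes "0 < n"
  shows "fold_mat n * transpose_mat (fold_mat n) = 1\<^sub>m (2 * n)"
proof (rule eq_matI)
  fix i k assume "i < dim_row (1\<^sub>m (2 * n) :: complex mat)" "k < dim_col (1\<^sub>m (2 * n) :: complex mat)"
  then have ik: "i < 2 * n" "k < 2 * n" by simp_all
  have "(fold_mat n * transpose_mat (fold_mat n)) $$ (i, k) =
      (\<Sum>j<Suc (2 * n). fold_mat n $$ (i, j) * fold_mat n $$ (k, j))"
    using ik by (simp add: scalar_prod_def lessThan_atLeast0 del: sum.lessThan_Suc sum.op_ivl_Suc)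
  \<comment> \<open>Column \<open>2n\<close> is split off because it shares row \<open>0\<close>
    with column \<open>0\<close>; their squared weights 1/2 and 1/2 add up to 1.\<close>
  also have "\<dots> = (\<Sum>j<2 * n. fold_mat n $$ (i, j) * fold_mat n $$ (k, j)) +
      fold_mat n $$ (i, 2 * n) * fold_mat n $$ (k, 2 * n)" by (rule sum.lessThan_Suc)
  also have "(\<Sum>j<2 * n. fold_mat n $$ (i, j) * fold_mat n $$ (k, j)) =
      (\<Sum>j<2 * n. if j = i then (if k = i then fold_weight n i * fold_weight n i else 0) else 0)"
    using ik by (intro sum.cong) (auto simp: fold_mat_def)
  also have "\<dots> = (if k = i then fold_weight n i * fold_weight n i else 0)"
    using ik by simp
  also have "fold_mat n $$ (i, 2 * n) * fold_mat n $$ (k, 2 * n) = (if i = 0 \<and> k = 0 then 1 / 2 else 0)"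
    using ik assms by (simp add: fold_mat_def fold_weight_def complex_sqrt2_square)
  finally show "(fold_mat n * transpose_mat (fold_mat n)) $$ (i, k) = 1\<^sub>m (2 * n) $$ (i, k)"
    using ik by (simp add: fold_weight_def complex_sqrt2_square)
qed simp_all

text \<open>The spectral projection of the involution \<open>Lambda1\<close> onto its -1
  eigenspace.\<close>

definition half_proj :: "nat \<Rightarrow> complex mat" where
  "half_proj n = (1 / 2) \<cdot>\<^sub>m (1\<^sub>m (Suc (2 * n)) - Lambda1 n)"

lemma half_proj_carrier [simp]: "half_proj n \<in> carrier_mat (Suc (2 * n)) (Suc (2 * n))"
  unfolding half_proj_def by (intro smult_carrier_mat minus_carrier_mat Lambda1_carrier)

lemma half_proj_dim [simp]: "dim_row (half_proj n) = Suc (2 * n)" "dim_col (half_proj n) = Suc (2 * n)"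
  using carrier_matD[OF half_proj_carrier] by blast+

lemma fold_mat_projection:
  assumes "0 < n"
  shows "transpose_mat (fold_mat n) * fold_mat n = half_proj n"
proof (rule eq_matI)
  fix i j assume "i < dim_row (half_proj n)" "j < dim_col (half_proj n)"
  then have ij: "i < Suc (2 * n)" "j < Suc (2 * n)" by simp_all
  \<comment> \<open>The only row of \<open>fold_mat\<close> in which column \<open>i\<close> is
    nonzero; two columns have a nonzero product exactly when these rows agree.\<close>
  define ci where "ci = (if i = 2 * n then 0 else i)"
  define cj where "cj = (if j = 2 * n then 0 else j)"
  have ci: "ci < 2 * n" using ij assms by (auto simp: ci_def)
  have "(transpose_mat (fold_mat n) * fold_mat n) $$ (i, j) =
      (\<Sum>k<2 * n. fold_mat n $$ (k, i) * fold_mat n $$ (k, j))"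
    using ij by (simp add: scalar_prod_def lessThan_atLeast0)
  also have "\<dots> = (\<Sum>k<2 * n. if k = ci then (if ci = cj then fold_weight n i * fold_weight n j else 0) else 0)"
    using ij by (intro sum.cong) (auto simp: fold_mat_def ci_def cj_def)
  also have "\<dots> = (if ci = cj then fold_weight n i * fold_weight n j else 0)"
    using ci by simp
  also have "\<dots> = half_proj n $$ (i, j)"
  proof -
    have half: "half_proj n $$ (i, j) =
        (1 / 2) * ((if i = j then 1 else 0) - (if j = swap_ends n i then end_sign n i else 0))"
      using ij assms by (simp add: half_proj_def Lambda1_index)
    consider "i = 0" | "i = 2 * n" | "0 < i" "i < 2 * n" using ij by linarith
    then show ?thesis unfolding half
      by cases (use ij assms in \<open>simp_all add: ci_def cj_def fold_weight_def middle_simps complex_sqrt2_square\<close>)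
  qed
  finally show "(transpose_mat (fold_mat n) * fold_mat n) $$ (i, j) = half_proj n $$ (i, j)" .
qed simp_all

definition g0_frame :: "nat \<Rightarrow> complex mat" where
  "g0_frame n = fold_mat n * reversal_root (Suc (2 * n))"

lemma g0_frame_carrier [simp]: "g0_frame n \<in> carrier_mat (2 * n) (Suc (2 * n))"
  unfolding g0_frame_def by (intro mult_carrier_mat[OF fold_mat_carrier reversal_root_carrier])

lemma g0_frame_orthonormal:
  assumes "0 < n"
  shows "g0_frame n * (reversal_mat (Suc (2 * n)) * transpose_mat (g0_frame n)) = 1\<^sub>m (2 * n)"
proof -
  let ?C = "fold_mat n" and ?P = "reversal_root (Suc (2 * n))" and ?J = "reversal_mat (Suc (2 * n))"
  have "g0_frame n * (?J * transpose_mat (g0_frame n)) = ?C * ((?P * (?J * ?P)) * transpose_mat ?C)"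
    by (simp add: g0_frame_def transpose_mult_dim assoc_mult_mat_dim del: reversal_root_conj)
  also have "\<dots> = ?C * transpose_mat ?C"
    by simp
  finally show ?thesis by (simp add: fold_mat_coisometry[OF assms])
qed

text \<open>\<open>P\<close> is a linear combination of 1 and \<open>J\<close>, and \<open>J\<close>
  commutes with \<open>Lambda1\<close>. Thus \<open>P\<close> preserves the eigenspaces of
  \<open>Lambda1\<close>.\<close>

lemma half_proj_reversal_root:
  assumes "0 < n"
  shows "half_proj n * reversal_root (Suc (2 * n)) = reversal_root (Suc (2 * n)) * half_proj n"
proof -
  let ?N = "Suc (2 * n)"
  have "Lambda1 n * reversal_root ?N = reversal_root ?N * Lambda1 n"
    by (simp add: reversal_root_def mult_add_distrib_mat[of _ ?N ?N _ ?N] add_mult_distrib_mat[of _ ?N ?N _ _ ?N]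
        mult_smult_distrib[of _ ?N ?N _ ?N] mult_smult_assoc_mat[of _ ?N ?N _ ?N] Lambda1_reversal_commute[OF assms])
  then show ?thesis
    by (simp add: half_proj_def mult_minus_distrib_mat[of _ ?N ?N _ ?N] minus_mult_distrib_mat[of _ ?N ?N _ _ ?N]
        mult_smult_distrib[of _ ?N ?N _ ?N] mult_smult_assoc_mat[of _ ?N ?N _ ?N] minus_carrier_mat)
qed

text \<open>Once \<open>P\<close> has moved past \<open>half_proj\<close>, the remaining factor is
  \<open>J P\<^sup>2 = J\<^sup>2 = 1\<close>.\<close>

lemma g0_frame_projection:
  assumes "0 < n"
  shows "reversal_mat (Suc (2 * n)) * transpose_mat (g0_frame n) * g0_frame n = half_proj n"
proof -
  let ?C = "fold_mat n" and ?P = "reversal_root (Suc (2 * n))" and ?J = "reversal_mat (Suc (2 * n))"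
  have "?J * transpose_mat (g0_frame n) * g0_frame n = ?J * ?P * ((transpose_mat ?C * ?C) * ?P)"
    by (simp add: g0_frame_def transpose_mult_dim assoc_mult_mat_dim)
  also have "\<dots> = ?J * (?P * ?P) * half_proj n"
    unfolding fold_mat_projection[OF assms] half_proj_reversal_root[OF assms]
    by (simp add: assoc_mult_mat_dim del: reversal_root_square)
  also have "\<dots> = half_proj n"
    by (simp add: assoc_mult_mat_dim)
  finally show ?thesis .
qed

lemma index_mult_half_proj:
  assumes "0 < n" "Z \<in> carrier_mat k (Suc (2 * n))" "i < k" "j < Suc (2 * n)"
  shows "(Z * half_proj n) $$ (i, j) = (1 / 2) * (Z $$ (i, j) - end_sign n j * Z $$ (i, swap_ends n j))"
proof -
  let ?N = "Suc (2 * n)"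
  have ZL: "Z * Lambda1 n \<in> carrier_mat k ?N" by (rule mult_carrier_mat[OF assms(2) Lambda1_carrier])
  have "Z * half_proj n = (1 / 2) \<cdot>\<^sub>m (Z - Z * Lambda1 n)"
    using assms(2)
    by (simp add: half_proj_def mult_minus_distrib_mat[of _ k ?N _ ?N] mult_smult_distrib[of _ k ?N _ ?N]
        minus_carrier_mat)
  moreover have "\<dots> $$ (i, j) = (1 / 2) * (Z $$ (i, j) - (Z * Lambda1 n) $$ (i, j))"
    using assms ZL by (simp del: index_mult_mat(1))
  ultimately show ?thesis by (simp only: index_mult_Lambda1[OF assms])
qed

lemma Lambda1_half_proj:
  assumes "0 < n"
  shows "Lambda1 n * half_proj n = - half_proj n" "half_proj n * Lambda1 n = - half_proj n"
proof -
  let ?N = "Suc (2 * n)"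
  have *: "(1 / 2) \<cdot>\<^sub>m (Lambda1 n - 1\<^sub>m ?N) = - half_proj n"
    unfolding half_proj_def by (rule eq_matI) (simp_all add: field_simps)
  show "Lambda1 n * half_proj n = - half_proj n" "half_proj n * Lambda1 n = - half_proj n"
    unfolding *[symmetric] unfolding half_proj_def
    by (simp_all add: mult_minus_distrib_mat[of _ ?N ?N _ ?N] minus_mult_distrib_mat[of _ ?N ?N _ _ ?N]
        mult_smult_distrib[of _ ?N ?N _ ?N] mult_smult_assoc_mat[of _ ?N ?N _ ?N] minus_carrier_mat
        Lambda1_involution[OF assms])
qed

text \<open>An element of \<open>g0\<close> annihilates \<open>e_0 + e_2n\<close>, so projecting
  away from that line first changes nothing. Conversely, an element fixed by
  \<open>half_proj\<close> on both sides is negated by \<open>Lambda1\<close> on either side, and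
  the two signs cancel in \<open>theta\<close>.\<close>

lemma g0_eq_compression:
  assumes "0 < n"
  shows "g0 n = {Z \<in> so_rev (Suc (2 * n)).
     Z * (reversal_mat (Suc (2 * n)) * transpose_mat (g0_frame n) * g0_frame n) = Z}" (is "_ = ?L")
proof (intro Set.set_eqI iffI)
  fix Z assume g0: "Z \<in> g0 n"
  have Z: "Z \<in> carrier_mat (Suc (2 * n)) (Suc (2 * n))" by (rule g0_carrier[OF g0])
  note entries = g0_entries[OF assms g0]
  have "Z * half_proj n = Z"
  proof (rule eq_matI)
    fix i j assume "i < dim_row Z" "j < dim_col Z"
    then have ij: "i < Suc (2 * n)" "j < Suc (2 * n)" using Z by simp_all
    \<comment> \<open>In terms of columns, \<open>Z\<close> annihilates the +1 eigenvector
      \<open>e_0 + e_2n\<close>.\<close>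
    have last: "Z $$ (i, 2 * n) = - Z $$ (i, 0)"
    proof -
      consider "i = 0" | "i = 2 * n" | "0 < i" "i < 2 * n" using ij by linarith
      then show ?thesis by cases (simp_all add: entries)
    qed
    have "end_sign n j * Z $$ (i, swap_ends n j) = - Z $$ (i, j)"
    proof -
      consider "j = 0" | "j = 2 * n" | "0 < j" "j < 2 * n" using ij by linarith
      then show ?thesis by cases (simp_all add: last middle_simps)
    qed
    then show "(Z * half_proj n) $$ (i, j) = Z $$ (i, j)"
      by (simp only: index_mult_half_proj[OF assms Z ij]) simp
  qed (use Z in simp_all)
  then show "Z \<in> ?L" using g0 by (simp add: g0_frame_projection[OF assms] g0_iff)
next
  fix Z assume L: "Z \<in> ?L"
  then have so: "Z \<in> so_rev (Suc (2 * n))" and right: "Z * half_proj n = Z"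
    by (simp_all add: g0_frame_projection[OF assms])
  have Z: "Z \<in> carrier_mat (Suc (2 * n)) (Suc (2 * n))" by (rule so_rev_carrier[OF so])
  have left: "half_proj n * Z = Z"
    using so_rev_compression(3)[OF g0_frame_carrier g0_frame_orthonormal[OF assms] L]
    by (simp only: g0_frame_projection[OF assms])
  have "Lambda1 n * Z = Lambda1 n * half_proj n * Z"
    using Z by (simp add: assoc_mult_mat_dim left)
  also have "\<dots> = - Z" using Z by (simp add: Lambda1_half_proj[OF assms] left)
  finally have "Lambda1 n * Z = - Z" .
  moreover have "Z * Lambda1 n = - Z"
  proof -
    have "Z * Lambda1 n = Z * half_proj n * Lambda1 n" by (simp only: right)
    also have "\<dots> = Z * - half_proj n"
      using Z by (simp add: assoc_mult_mat_dim Lambda1_half_proj[OF assms])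
    also have "\<dots> = - Z" using Z by (simp add: right)
    finally show ?thesis .
  qed
  ultimately have "theta n Z = Z" using Z by (simp add: theta_eq[OF assms])
  then show "Z \<in> g0 n" using so by (simp add: g0_iff)
qed

lemma g0_lie_algebra:
  assumes "0 < n"
  shows "mat_lie_algebra (Suc (2 * n)) (g0 n)"
  using so_rev_compression(1)[OF g0_frame_carrier g0_frame_orthonormal[OF assms]]
  by (simp only: g0_eq_compression[OF assms])

lemma g0_lie_isomorphic:
  assumes "0 < n"
  shows "lie_isomorphic (Suc (2 * n)) (g0 n) (2 * n) (so_alg (2 * n))"
  using so_rev_compression(2)[OF g0_frame_carrier g0_frame_orthonormal[OF assms]]
  unfolding lie_isomorphic_def g0_eq_compression[OF assms] by blast

section \<open>Matrices supported on the border\<close>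

text \<open>A common shape for \<open>V_space\<close> (\<open>s = -1\<close>, \<open>d = 0\<close>)
  and \<open>g1\<close> (\<open>s = 1\<close>, any \<open>d\<close>). The first column is
  prescribed, \<open>s\<close> relates the last column to it in the middle rows, and reflection in
  the anti-diagonal forces the remaining entries.\<close>

definition border_mat :: "nat \<Rightarrow> complex \<Rightarrow> complex \<Rightarrow> (nat \<Rightarrow> complex) \<Rightarrow> complex mat" where
  "border_mat n s d c = mat (Suc (2 * n)) (Suc (2 * n)) (\<lambda>(i, j).
     if 0 < i \<and> i < 2 * n then (if j = 0 then c i else if j = 2 * n then s * c i else 0)
     else if i = 0 then (if j = 0 then d else if j = 2 * n then 0 else - s * c (2 * n - j))
     else (if j = 0 then 0 else if j = 2 * n then - d else - c (2 * n - j)))"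

lemma border_mat_carrier [simp]: "border_mat n s d c \<in> carrier_mat (Suc (2 * n)) (Suc (2 * n))"
  by (simp add: border_mat_def)

lemma border_mat_so_rev:
  assumes "0 < n"
  shows "border_mat n s d c \<in> so_rev (Suc (2 * n))"
  unfolding so_rev_iff_index
proof (intro conjI allI impI)
  fix i j assume ij: "i < Suc (2 * n)" "j < Suc (2 * n)"
  consider "i = 0" | "i = 2 * n" | "0 < i" "i < 2 * n" using ij by linarith
  then show "border_mat n s d c $$ (i, j) =
      - border_mat n s d c $$ (Suc (2 * n) - 1 - j, Suc (2 * n) - 1 - i)"
  proof cases
    case 1
    consider "j = 0" | "j = 2 * n" | "0 < j" "j < 2 * n" using ij by linarith
    then show ?thesis by cases (use 1 assms in \<open>simp_all add: border_mat_def\<close>)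
  next
    case 2
    consider "j = 0" | "j = 2 * n" | "0 < j" "j < 2 * n" using ij by linarith
    then show ?thesis by cases (use 2 assms in \<open>simp_all add: border_mat_def\<close>)
  next
    case 3
    then have reflected: "2 * n - i \<noteq> 2 * n" by linarith
    consider "j = 0" | "j = 2 * n" | "0 < j" "j < 2 * n" using ij by linarith
    then show ?thesis by cases (use 3 assms reflected in \<open>simp_all add: border_mat_def\<close>)
  qed
qed simp

text \<open>\<open>theta\<close> interchanges the corner entries \<open>d\<close> and
  \<open>- d\<close>, so the factor \<open>- s\<close> requires \<open>s * d = d\<close>: at
  \<open>s = -1\<close> this means \<open>d = 0\<close>.\<close>

lemma theta_border_mat:
  assumes "0 < n" and s: "s * s = 1" and sd: "s * d = d"
  shows "theta n (border_mat n s d c) = - s \<cdot>\<^sub>m border_mat n s d c"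
proof (rule eq_matI)
  fix i j assume "i < dim_row (- s \<cdot>\<^sub>m border_mat n s d c)" "j < dim_col (- s \<cdot>\<^sub>m border_mat n s d c)"
  then have ij: "i < Suc (2 * n)" "j < Suc (2 * n)" by (simp_all add: border_mat_def)
  have s': "s * (s * x) = x" for x using s by (simp flip: mult.assoc)
  have "end_sign n i * end_sign n j * border_mat n s d c $$ (swap_ends n i, swap_ends n j) =
      - s * border_mat n s d c $$ (i, j)"
  proof -
    consider "i = 0" | "i = 2 * n" | "0 < i" "i < 2 * n" using ij by linarith
    then show ?thesis
    proof cases
      case 1
      consider "j = 0" | "j = 2 * n" | "0 < j" "j < 2 * n" using ij by linarith
      then show ?thesis by cases (use 1 assms in \<open>simp_all add: border_mat_def middle_simps s'\<close>)
    next
      case 2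
      consider "j = 0" | "j = 2 * n" | "0 < j" "j < 2 * n" using ij by linarith
      then show ?thesis by cases (use 2 assms in \<open>simp_all add: border_mat_def middle_simps s'\<close>)
    next
      case 3
      consider "j = 0" | "j = 2 * n" | "0 < j" "j < 2 * n" using ij by linarith
      then show ?thesis by cases (use 3 assms in \<open>simp_all add: border_mat_def middle_simps s'\<close>)
    qed
  qed
  then show "theta n (border_mat n s d c) $$ (i, j) = (- s \<cdot>\<^sub>m border_mat n s d c) $$ (i, j)"
    using ij by (simp only: theta_index[OF assms(1) border_mat_carrier ij]) (simp add: border_mat_def)
next
  have "theta n (border_mat n s d c) \<in> carrier_mat (Suc (2 * n)) (Suc (2 * n))"
    by (rule theta_carrier[OF assms(1) border_mat_carrier])
  then show "dim_row (theta n (border_mat n s d c)) = dim_row (- s \<cdot>\<^sub>m border_mat n s d c)"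
    "dim_col (theta n (border_mat n s d c)) = dim_col (- s \<cdot>\<^sub>m border_mat n s d c)"
    by (simp_all add: border_mat_def)
qed

lemma border_mat_V_space:
  assumes "0 < n"
  shows "border_mat n (- 1) 0 c \<in> V_space n"
proof -
  have "theta n (border_mat n (- 1) 0 c) = border_mat n (- 1) 0 c"
    by (subst theta_border_mat[OF assms]) (auto intro: eq_matI)
  moreover have "border_mat n (- 1) 0 c $$ (i, j) = 0" if "i \<in> {1..2 * n - 1}" "j \<in> {1..2 * n - 1}" for i j
  proof -
    have "0 < i" "i < 2 * n" "0 < j" "j < 2 * n" using that by auto
    then show ?thesis by (simp add: border_mat_def)
  qed
  ultimately show ?thesis by (simp add: V_space_def g0_iff border_mat_so_rev[OF assms])
qed

lemma border_mat_g1: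
  assumes "0 < n"
  shows "border_mat n 1 d c \<in> g1 n"
proof -
  have "theta n (border_mat n 1 d c) = - border_mat n 1 d c"
    by (subst theta_border_mat[OF assms]) (auto intro: eq_matI)
  then show ?thesis by (simp add: g1_iff border_mat_so_rev[OF assms])
qed

lemma V_space_iff:
  "Z \<in> V_space n \<longleftrightarrow> Z \<in> g0 n \<and>
     (\<forall>i j. 0 < i \<and> i < 2 * n \<and> 0 < j \<and> j < 2 * n \<longrightarrow> Z $$ (i, j) = 0)"
proof -
  have "i \<in> {1..2 * n - 1} \<longleftrightarrow> 0 < i \<and> i < 2 * n" for i by auto
  then show ?thesis unfolding V_space_def by blast
qed

lemma V_space_subspace:
  assumes "0 < n"
  shows "mat_subspace (Suc (2 * n)) (V_space n)"
proof (rule mat_subspaceI)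
  fix X Y assume "X \<in> V_space n" "Y \<in> V_space n"
  then have XY: "X \<in> g0 n" "Y \<in> g0 n"
    and 0: "\<And>i j. 0 < i \<Longrightarrow> i < 2 * n \<Longrightarrow> 0 < j \<Longrightarrow> j < 2 * n \<Longrightarrow> X $$ (i, j) = 0"
      "\<And>i j. 0 < i \<Longrightarrow> i < 2 * n \<Longrightarrow> 0 < j \<Longrightarrow> j < 2 * n \<Longrightarrow> Y $$ (i, j) = 0"
    by (simp_all add: V_space_iff)
  then show "X + Y \<in> V_space n"
    using mat_subspaceD(3)[OF g0_subspace[OF assms] XY] g0_carrier[OF XY(1)] g0_carrier[OF XY(2)]
    by (simp add: V_space_iff)
next
  fix c X assume "X \<in> V_space n"
  then have X: "X \<in> g0 n"
    and 0: "\<And>i j. 0 < i \<Longrightarrow> i < 2 * n \<Longrightarrow> 0 < j \<Longrightarrow> j < 2 * n \<Longrightarrow> X $$ (i, j) = 0"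
    by (simp_all add: V_space_iff)
  then show "c \<cdot>\<^sub>m X \<in> V_space n"
    using mat_subspaceD(4)[OF g0_subspace[OF assms] X] g0_carrier[OF X]
    by (simp add: V_space_iff)
qed (use mat_subspaceD(2)[OF g0_subspace[OF assms]] in \<open>auto simp: V_space_iff g0_carrier\<close>)

text \<open>By \<open>g0_entries\<close> each border entry is zero or, up to sign, an entry of the
  first column.\<close>

lemma V_space_zero:
  assumes "0 < n" "Z \<in> V_space n" "\<And>i. 0 < i \<Longrightarrow> i < 2 * n \<Longrightarrow> Z $$ (i, 0) = 0"
  shows "Z = 0\<^sub>m (Suc (2 * n)) (Suc (2 * n))"
proof (rule eq_matI)
  have g0: "Z \<in> g0 n" using assms(2) by (simp add: V_space_iff)
  have Z: "Z \<in> carrier_mat (Suc (2 * n)) (Suc (2 * n))" by (rule g0_carrier[OF g0])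
  then show "dim_row Z = dim_row (0\<^sub>m (Suc (2 * n)) (Suc (2 * n)) :: complex mat)"
    "dim_col Z = dim_col (0\<^sub>m (Suc (2 * n)) (Suc (2 * n)) :: complex mat)" by simp_all
  fix i j assume "i < dim_row (0\<^sub>m (Suc (2 * n)) (Suc (2 * n)) :: complex mat)"
    "j < dim_col (0\<^sub>m (Suc (2 * n)) (Suc (2 * n)) :: complex mat)"
  then have ij: "i < Suc (2 * n)" "j < Suc (2 * n)" by simp_all
  note entries = g0_entries[OF assms(1) g0]
  have mid: "Z $$ (i, j) = 0" if "0 < i" "i < 2 * n" "0 < j" "j < 2 * n"
    using assms(2) that by (simp add: V_space_iff)
  consider "j = 0" | "j = 2 * n" | "0 < j" "j < 2 * n" using ij by linarith
  then have "Z $$ (i, j) = 0"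
  proof cases
    case 1
    consider "i = 0" | "i = 2 * n" | "0 < i" "i < 2 * n" using ij by linarith
    then show ?thesis by cases (simp_all add: 1 entries assms(3))
  next
    case 2
    consider "i = 0" | "i = 2 * n" | "0 < i" "i < 2 * n" using ij by linarith
    then show ?thesis by cases (simp_all add: 2 entries assms(3))
  next
    case 3
    consider "i = 0" | "i = 2 * n" | "0 < i" "i < 2 * n" using ij by linarith
    then show ?thesis by cases (use 3 in \<open>simp_all add: entries assms(3) mid\<close>)
  qed
  then show "Z $$ (i, j) = 0\<^sub>m (Suc (2 * n)) (Suc (2 * n)) $$ (i, j)" using ij by simp
qed

lemma V_space_dim:
  assumes "0 < n"
  shows "has_dim (Suc (2 * n)) (V_space n) (2 * n - 1)"
proof -
  \<comment> \<open>The first column without its two corners, which vanish on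
    \<open>g0\<close>.\<close>
  let ?I = "(\<lambda>i. (i, 0 :: nat)) ` {1..<2 * n}"
  have "has_dim (Suc (2 * n)) (V_space n) (card ?I)"
  proof (rule has_dimI_coordinates[OF V_space_subspace[OF assms]])
    show "finite ?I" by simp
    show "?I \<subseteq> {..<Suc (2 * n)} \<times> {..<Suc (2 * n)}" by auto
    show "Z = 0\<^sub>m (Suc (2 * n)) (Suc (2 * n))" if "Z \<in> V_space n" "\<forall>p\<in>?I. Z $$ p = 0" for Z
      by (rule V_space_zero[OF assms that(1)]) (use that(2) in simp)
    show "\<exists>Z\<in>V_space n. \<forall>p\<in>?I. Z $$ p = f p" for f
      by (rule bexI[OF _ border_mat_V_space[OF assms, of "\<lambda>i. f (i, 0)"]]) (auto simp: border_mat_def)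
  qed
  moreover have "card ?I = 2 * n - 1" by (simp add: card_image inj_on_def)
  ultimately show ?thesis by simp
qed

lemma g1_dim:
  assumes "0 < n"
  shows "has_dim (Suc (2 * n)) (g1 n) (2 * n)"
proof -
  \<comment> \<open>The first column without its bottom corner. The top corner is free on
    \<open>g1\<close>, which gives one dimension more than for \<open>V_space\<close>.\<close>
  let ?I = "(\<lambda>i. (i, 0 :: nat)) ` {..<2 * n}"
  have "has_dim (Suc (2 * n)) (g1 n) (card ?I)"
  proof (rule has_dimI_coordinates[OF g1_subspace[OF assms]])
    show "finite ?I" by simp
    show "?I \<subseteq> {..<Suc (2 * n)} \<times> {..<Suc (2 * n)}" by auto
    show "Z = 0\<^sub>m (Suc (2 * n)) (Suc (2 * n))" if g1: "Z \<in> g1 n" and "\<forall>p\<in>?I. Z $$ p = 0" for Z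
    proof (rule eq_matI)
      have Z: "Z \<in> carrier_mat (Suc (2 * n)) (Suc (2 * n))" by (rule g1_carrier[OF g1])
      then show "dim_row Z = dim_row (0\<^sub>m (Suc (2 * n)) (Suc (2 * n)) :: complex mat)"
        "dim_col Z = dim_col (0\<^sub>m (Suc (2 * n)) (Suc (2 * n)) :: complex mat)" by simp_all
      fix i j assume "i < dim_row (0\<^sub>m (Suc (2 * n)) (Suc (2 * n)) :: complex mat)"
        "j < dim_col (0\<^sub>m (Suc (2 * n)) (Suc (2 * n)) :: complex mat)"
      then have ij: "i < Suc (2 * n)" "j < Suc (2 * n)" by simp_all
      note entries = g1_entries[OF assms g1]
      have col: "Z $$ (k, 0) = 0" if "k < 2 * n" for k
        using \<open>\<forall>p\<in>?I. Z $$ p = 0\<close> that by simp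
      have col0: "Z $$ (0, 0) = 0" using col assms by simp
      consider "j = 0" | "j = 2 * n" | "0 < j" "j < 2 * n" using ij by linarith
      then have "Z $$ (i, j) = 0"
      proof cases
        case 1
        consider "i = 0" | "i = 2 * n" | "0 < i" "i < 2 * n" using ij by linarith
        then show ?thesis by cases (simp_all add: 1 entries col col0)
      next
        case 2
        consider "i = 0" | "i = 2 * n" | "0 < i" "i < 2 * n" using ij by linarith
        then show ?thesis by cases (simp_all add: 2 entries col col0)
      next
        case 3
        consider "i = 0" | "i = 2 * n" | "0 < i" "i < 2 * n" using ij by linarith
        then show ?thesis by cases (use 3 in \<open>simp_all add: entries col col0\<close>)
      qed
      then show "Z $$ (i, j) = 0\<^sub>m (Suc (2 * n)) (Suc (2 * n)) $$ (i, j)" using ij by simp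
    qed
    show "\<exists>Z\<in>g1 n. \<forall>p\<in>?I. Z $$ p = f p" for f
      by (rule bexI[OF _ border_mat_g1[OF assms, of "f (0, 0)" "\<lambda>i. f (i, 0)"]]) (auto simp: border_mat_def)
  qed
  moreover have "card ?I = 2 * n" by (simp add: card_image inj_on_def)
  ultimately show ?thesis by simp
qed

section \<open>The subalgebra of the middle block\<close>

lemma g0_tilde_entries:
  assumes "Z \<in> g0_tilde n" "i \<le> 2 * n" "j \<le> 2 * n" "\<not> (0 < i \<and> i < 2 * n \<and> 0 < j \<and> j < 2 * n)"
  shows "Z $$ (i, j) = 0"
proof -
  have "i \<in> {0, 2 * n} \<or> j \<in> {0, 2 * n}" using assms(2-4) by auto
  then show ?thesis using assms(1-3) unfolding g0_tilde_iff by blast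
qed

lemma g0_tilde_carrier: "Z \<in> g0_tilde n \<Longrightarrow> Z \<in> carrier_mat (Suc (2 * n)) (Suc (2 * n))"
  by (simp add: g0_tilde_iff so_rev_carrier)

text \<open>In the middle block two signs -1 cancel; outside it, \<open>swap_ends\<close> maps
  border positions to border positions, where all entries are zero.\<close>

lemma g0_tilde_subset_g0:
  assumes "0 < n"
  shows "g0_tilde n \<subseteq> g0 n"
proof
  fix Z assume Z: "Z \<in> g0_tilde n"
  have c: "Z \<in> carrier_mat (Suc (2 * n)) (Suc (2 * n))" by (rule g0_tilde_carrier[OF Z])
  have "theta n Z = Z"
  proof (rule eq_matI)
    fix i j assume "i < dim_row Z" "j < dim_col Z"
    then have ij: "i < Suc (2 * n)" "j < Suc (2 * n)" using c by simp_all
    show "theta n Z $$ (i, j) = Z $$ (i, j)"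
    proof (cases "0 < i \<and> i < 2 * n \<and> 0 < j \<and> j < 2 * n")
      case True
      then show ?thesis unfolding theta_index[OF assms c ij] by (simp add: middle_simps)
    next
      case False
      have "swap_ends n i \<le> 2 * n" "swap_ends n j \<le> 2 * n"
        using swap_ends_less[OF ij(1)] swap_ends_less[OF ij(2)] by simp_all
      moreover have "\<not> (0 < swap_ends n i \<and> swap_ends n i < 2 * n \<and> 0 < swap_ends n j \<and> swap_ends n j < 2 * n)"
        using False ij unfolding swap_ends_def by presburger
      ultimately have "Z $$ (swap_ends n i, swap_ends n j) = 0" by (rule g0_tilde_entries[OF Z])
      moreover have "Z $$ (i, j) = 0" using False ij by (intro g0_tilde_entries[OF Z]) simp_all
      ultimately show ?thesis unfolding theta_index[OF assms c ij] by simp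
    qed
  qed (use theta_carrier[OF assms c] c in auto)
  then show "Z \<in> g0 n" using Z by (simp add: g0_iff g0_tilde_iff)
qed

text \<open>Used both to project \<open>g0\<close> onto \<open>g0_tilde\<close> and to build
  elements of \<open>g0_tilde\<close> with prescribed entries.\<close>

definition middle_part :: "nat \<Rightarrow> (nat \<times> nat \<Rightarrow> complex) \<Rightarrow> complex mat" where
  "middle_part n f = mat (Suc (2 * n)) (Suc (2 * n))
     (\<lambda>(i, j). if 0 < i \<and> i < 2 * n \<and> 0 < j \<and> j < 2 * n then f (i, j) else 0)"

lemma middle_part_g0_tilde:
  assumes "\<And>i j. 0 < i \<Longrightarrow> i < 2 * n \<Longrightarrow> 0 < j \<Longrightarrow> j < 2 * n \<Longrightarrow> f (i, j) = - f (2 * n - j, 2 * n - i)"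
  shows "middle_part n f \<in> g0_tilde n"
  unfolding g0_tilde_iff
proof
  show "middle_part n f \<in> so_rev (Suc (2 * n))"
    unfolding so_rev_iff_index
  proof (intro conjI allI impI)
    fix i j assume ij: "i < Suc (2 * n)" "j < Suc (2 * n)"
    have iff: "0 < 2 * n - j \<and> 2 * n - j < 2 * n \<and> 0 < 2 * n - i \<and> 2 * n - i < 2 * n \<longleftrightarrow>
        0 < i \<and> i < 2 * n \<and> 0 < j \<and> j < 2 * n"
      using ij by linarith
    have bounds: "Suc (2 * n) - 1 - j = 2 * n - j" "Suc (2 * n) - 1 - i = 2 * n - i"
      "2 * n - j < Suc (2 * n)" "2 * n - i < Suc (2 * n)" by simp_all
    have entry: "middle_part n f $$ (k, l) = (if 0 < k \<and> k < 2 * n \<and> 0 < l \<and> l < 2 * n then f (k, l) else 0)"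
      if "k < Suc (2 * n)" "l < Suc (2 * n)" for k l
      using that by (simp add: middle_part_def)
    show "middle_part n f $$ (i, j) = - middle_part n f $$ (Suc (2 * n) - 1 - j, Suc (2 * n) - 1 - i)"
    proof (cases "0 < i \<and> i < 2 * n \<and> 0 < j \<and> j < 2 * n")
      case True
      then show ?thesis
        unfolding bounds(1,2) entry[OF ij] entry[OF bounds(3,4)] iff
        by (simp only: if_True simp_thms) (rule assms; simp only: True)
    next
      case False
      then show ?thesis
        unfolding bounds(1,2) entry[OF ij] entry[OF bounds(3,4)] iff by (simp only: if_False minus_zero)
    qed
  qed (simp add: middle_part_def)
qed (auto simp: middle_part_def)

lemma g0_direct_sum:
  assumes "0 < n"
  shows "internal_direct_sum (Suc (2 * n)) (g0 n) (g0_tilde n) (V_space n)"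
proof (rule internal_direct_sumI)
  let ?N = "Suc (2 * n)"
  show "mat_subspace ?N (g0 n)" "mat_subspace ?N (V_space n)"
    by (rule g0_subspace[OF assms], rule V_space_subspace[OF assms])
  show "mat_subspace ?N (g0_tilde n)"
    using g0_tilde_lie_algebra by (simp add: mat_lie_algebra_def)
  show "g0_tilde n \<subseteq> g0 n" "V_space n \<subseteq> g0 n"
    using g0_tilde_subset_g0[OF assms] by (auto simp: V_space_iff)
  show "\<exists>X\<in>g0_tilde n. \<exists>Y\<in>V_space n. Z = X + Y" if Z: "Z \<in> g0 n" for Z
  proof (intro bexI)
    let ?X = "middle_part n (\<lambda>p. Z $$ p)" and ?Y = "Z + (- 1) \<cdot>\<^sub>m middle_part n (\<lambda>p. Z $$ p)"
    have so: "Z \<in> so_rev ?N" using Z by (simp add: g0_iff)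
    have c: "Z \<in> carrier_mat ?N ?N" "?X \<in> carrier_mat ?N ?N"
      using g0_carrier[OF Z] by (simp_all add: middle_part_def)
    show X: "?X \<in> g0_tilde n"
      by (rule middle_part_g0_tilde) (rule so_rev_odd_index[OF so]; simp)
    then have "?X \<in> g0 n" using g0_tilde_subset_g0[OF assms] by blast
    then have "?Y \<in> g0 n"
      by (intro mat_subspaceD(3)[OF g0_subspace[OF assms]] Z mat_subspaceD(4)[OF g0_subspace[OF assms]])
    then show "?Y \<in> V_space n" using c by (auto simp: V_space_iff middle_part_def)
    show "Z = ?X + ?Y" using c by (intro eq_matI) simp_all
  qed
  show "Z = 0\<^sub>m ?N ?N" if "Z \<in> g0_tilde n" "Z \<in> V_space n" for Z
    by (rule V_space_zero[OF assms that(2)]) (rule g0_tilde_entries[OF that(1)]; simp)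
qed

text \<open>Reflection in the anti-diagonal pairs the positions of the middle block with opposite
  entries and makes the anti-diagonal vanish. The entries strictly above it are free
  coordinates.\<close>

lemma g0_tilde_dim:
  assumes "0 < n"
  shows "has_dim (Suc (2 * n)) (g0_tilde n) ((n - 1) * (2 * n - 1))"
proof -
  let ?N = "Suc (2 * n)" and ?m = "2 * n - 1"
  \<comment> \<open>The positions of the middle block with \<open>i + j < 2n\<close>, shifted to
    start at \<open>0\<close> and listed by rows so that they can be counted.\<close>
  let ?I = "(\<lambda>(a, b). (Suc a, Suc b)) ` (SIGMA a:{..<?m}. {..<?m - Suc a})"
  have memI: "(i, j) \<in> ?I \<longleftrightarrow> 0 < i \<and> 0 < j \<and> i + j < 2 * n" for i j
  proof
    assume "0 < i \<and> 0 < j \<and> i + j < 2 * n"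
    then have "(i, j) = (\<lambda>(a, b). (Suc a, Suc b)) (i - 1, j - 1)"
      "(i - 1, j - 1) \<in> (SIGMA a:{..<?m}. {..<?m - Suc a})" by auto
    then show "(i, j) \<in> ?I" by (rule image_eqI)
  qed auto
  have subsp: "mat_subspace ?N (g0_tilde n)"
    using g0_tilde_lie_algebra by (simp add: mat_lie_algebra_def)
  have "has_dim ?N (g0_tilde n) (card ?I)"
  proof (rule has_dimI_coordinates[OF subsp])
    show "finite ?I" by (intro finite_imageI finite_SigmaI) simp_all
    show "?I \<subseteq> {..<?N} \<times> {..<?N}"
    proof
      fix p assume p: "p \<in> ?I"
      obtain i j where ij: "p = (i, j)" by (cases p)
      from p have "(i, j) \<in> ?I" unfolding ij .
      then have "i + j < 2 * n" unfolding memI by blast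
      then show "p \<in> {..<?N} \<times> {..<?N}" unfolding ij by simp
    qed
    show "Z = 0\<^sub>m ?N ?N" if Z: "Z \<in> g0_tilde n" and zero: "\<forall>p\<in>?I. Z $$ p = 0" for Z
    proof (rule eq_matI)
      fix i j assume "i < dim_row (0\<^sub>m ?N ?N :: complex mat)" "j < dim_col (0\<^sub>m ?N ?N :: complex mat)"
      then have ij: "i \<le> 2 * n" "j \<le> 2 * n" by simp_all
      have so: "Z \<in> so_rev ?N" using Z by (simp add: g0_tilde_iff)
      note refl = so_rev_odd_index[OF so ij]
      have "Z $$ (i, j) = 0"
      proof (cases "0 < i \<and> i < 2 * n \<and> 0 < j \<and> j < 2 * n")
        case False
        then show ?thesis by (rule g0_tilde_entries[OF Z ij])
      next
        case True
        consider "i + j < 2 * n" | "i + j > 2 * n" | "i + j = 2 * n" by linarith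
        then show ?thesis
        proof cases
          case 1
          then have "(i, j) \<in> ?I" unfolding memI using True by blast
          then show ?thesis by (rule bspec[OF zero])
        next
          case 2
          then have "(2 * n - j, 2 * n - i) \<in> ?I"
            unfolding memI by (intro conjI; use True in linarith)
          then have "Z $$ (2 * n - j, 2 * n - i) = 0" by (rule bspec[OF zero])
          then show ?thesis by (subst refl) simp
        next
          case 3
          then have diag: "2 * n - j = i" "2 * n - i = j" by linarith+
          show ?thesis using refl unfolding diag by (rule eq_uminus_self_complex)
        qed
      qed
      then show "Z $$ (i, j) = 0\<^sub>m ?N ?N $$ (i, j)" using ij by simp
    qed (use g0_tilde_carrier[OF Z] in simp_all)
    show "\<exists>Z\<in>g0_tilde n. \<forall>p\<in>?I. Z $$ p = f p" for f
    proof (rule bexI)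
      \<comment> \<open>The skew extension of the values prescribed above the anti-diagonal.\<close>
      let ?f = "\<lambda>(i, j). if i + j < 2 * n then f (i, j)
        else if i + j > 2 * n then - f (2 * n - j, 2 * n - i) else 0"
      show "middle_part n ?f \<in> g0_tilde n"
      proof (rule middle_part_g0_tilde)
        fix i j assume ij: "0 < i" "i < 2 * n" "0 < j" "j < 2 * n"
        then have 1: "2 * n - j + (2 * n - i) < 2 * n \<longleftrightarrow> i + j > 2 * n"
          "2 * n - j + (2 * n - i) > 2 * n \<longleftrightarrow> i + j < 2 * n"
          "2 * n - (2 * n - i) = i" "2 * n - (2 * n - j) = j" by linarith+
        show "?f (i, j) = - ?f (2 * n - j, 2 * n - i)"
          unfolding prod.case 1 by (cases "i + j < 2 * n"; cases "2 * n < i + j") simp_all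
      qed
      show "\<forall>p\<in>?I. middle_part n ?f $$ p = f p"
      proof
        fix p assume p: "p \<in> ?I"
        obtain i j where ij: "p = (i, j)" by (cases p)
        from p have "(i, j) \<in> ?I" unfolding ij .
        then have "0 < i" "0 < j" "i + j < 2 * n" unfolding memI by blast+
        then show "middle_part n ?f $$ p = f p" unfolding ij by (simp add: middle_part_def)
      qed
    qed
  qed
  moreover have "card ?I = (n - 1) * (2 * n - 1)"
  proof -
    have "card ?I = card (SIGMA a:{..<?m}. {..<?m - Suc a})"
      by (rule card_image) (auto simp: inj_on_def)
    also have "\<dots> = (\<Sum>a<?m. ?m - Suc a)" by simp
    also have "\<dots> = (\<Sum>a<?m. a)" by (rule sum.nat_diff_reindex)
    also have "\<dots> = ?m * (?m - 1) div 2"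
      by (simp only: lessThan_atLeast0 Sum_Ico_nat mult_0 diff_zero)
    also have "?m - 1 = 2 * (n - 1)" by simp
    also have "?m * (2 * (n - 1)) div 2 = (n - 1) * (2 * n - 1)" by (simp add: mult.left_commute mult.commute)
    finally show ?thesis .
  qed
  ultimately show ?thesis by (simp only:)
qed

section \<open>The vector representation\<close>

lemma index_mult_mat_vec_middle_proj:
  assumes "v \<in> carrier_vec (Suc (2 * n))" "i < Suc (2 * n)"
  shows "(middle_proj n *\<^sub>v v) $ i = (if 0 < i \<and> i < 2 * n then v $ i else 0)"
proof -
  have "(middle_proj n *\<^sub>v v) $ i =
      (\<Sum>l<Suc (2 * n). (if i = l \<and> 0 < i \<and> i < 2 * n then 1 else 0) * v $ l)"
    using assms
    by (simp add: middle_proj_def scalar_prod_def lessThan_atLeast0 del: sum.lessThan_Suc sum.op_ivl_Suc)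
  also have "\<dots> = (\<Sum>l<Suc (2 * n). if l = i then (if 0 < i \<and> i < 2 * n then v $ l else 0) else 0)"
    by (intro sum.cong) auto
  also have "\<dots> = (if 0 < i \<and> i < 2 * n then v $ i else 0)"
    using assms by (simp del: sum.lessThan_Suc)
  finally show ?thesis .
qed

text \<open>In a middle entry of \<open>X v\<close> or \<open>v X\<close> every summand vanishes: at
  a middle summation index the factor from \<open>v\<close> is zero, at an end index the factor from
  \<open>X\<close> is.\<close>

lemma lie_bracket_V_space:
  assumes "0 < n" "X \<in> g0_tilde n" "v \<in> V_space n"
  shows "lie_bracket X v \<in> V_space n"
proof -
  have X: "X \<in> carrier_mat (Suc (2 * n)) (Suc (2 * n))" by (rule g0_tilde_carrier[OF assms(2)])
  have v0: "v \<in> g0 n" and mid: "\<And>i j. 0 < i \<Longrightarrow> i < 2 * n \<Longrightarrow> 0 < j \<Longrightarrow> j < 2 * n \<Longrightarrow> v $$ (i, j) = 0"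
    using assms(3) by (simp_all add: V_space_iff)
  have v: "v \<in> carrier_mat (Suc (2 * n)) (Suc (2 * n))" by (rule g0_carrier[OF v0])
  have "lie_bracket X v \<in> g0 n"
    using g0_lie_algebra[OF assms(1)] g0_tilde_subset_g0[OF assms(1)] assms(2) v0
    unfolding mat_lie_algebra_def by blast
  moreover have "lie_bracket X v $$ (i, j) = 0" if ij: "0 < i" "i < 2 * n" "0 < j" "j < 2 * n" for i j
  proof (rule lie_bracket_index_zero[OF X v])
    fix k assume k: "k < Suc (2 * n)"
    show "X $$ (i, k) = 0 \<or> v $$ (k, j) = 0"
    proof (cases "0 < k \<and> k < 2 * n")
      case True
      then show ?thesis using mid ij by blast
    next
      case False
      then have "X $$ (i, k) = 0" using ij k by (intro g0_tilde_entries[OF assms(2)]) auto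
      then show ?thesis by blast
    qed
    show "v $$ (i, k) = 0 \<or> X $$ (k, j) = 0"
    proof (cases "0 < k \<and> k < 2 * n")
      case True
      then show ?thesis using mid ij by blast
    next
      case False
      then have "X $$ (k, j) = 0" using ij k by (intro g0_tilde_entries[OF assms(2)]) auto
      then show ?thesis by blast
    qed
  qed (use ij in simp_all)
  ultimately show ?thesis unfolding V_space_iff by blast
qed

text \<open>An element of \<open>V_space\<close> is determined by its first column. The first column of
  \<open>X \<in> g0_tilde\<close> vanishes, so the commutator with \<open>X\<close> acts on first columns as multiplication by \<open>X\<close>.\<close>

lemma V_space_vector_representation:
  assumes "0 < n"
  shows "is_vector_representation (2 * n - 1) (Suc (2 * n)) (g0_tilde n) (V_space n)"
proof -
  let ?N = "Suc (2 * n)" and ?m = "2 * n - 1"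
  define A where "A = middle_frame n"
  define B where "B = reversal_mat ?N * transpose_mat A"
  \<comment> \<open>The same frame \<open>A\<close> defines the Lie isomorphism, so the two
    identifications are compatible.\<close>
  define \<psi> where "\<psi> = (\<lambda>v :: complex mat. A *\<^sub>v col v 0)"
  have A: "A \<in> carrier_mat ?m ?N" unfolding A_def by (rule middle_frame_carrier)
  have B: "B \<in> carrier_mat ?N ?m"
    unfolding B_def using A by (intro mult_carrier_mat[OF reversal_mat_carrier]) simp
  have AB: "A * B = 1\<^sub>m ?m" unfolding A_def B_def by (rule middle_frame_orthonormal)
  have BA: "B * A = middle_proj n" unfolding A_def B_def by (rule middle_frame_projection)
  have carr: "v \<in> carrier_mat ?N ?N" if "v \<in> V_space n" for v
    using that by (simp add: V_space_iff g0_carrier)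
  have colc: "col v 0 \<in> carrier_vec ?N" if "v \<in> carrier_mat ?N ?N" for v :: "complex mat"
    using that by (intro carrier_vecI) simp
  note subsp = V_space_subspace[OF assms]
  have \<psi>_carr: "\<psi> v \<in> carrier_vec ?m" if "v \<in> V_space n" for v
    unfolding \<psi>_def by (rule mult_mat_vec_carrier[OF A colc[OF carr[OF that]]])
  have \<psi>_add: "\<psi> (u + v) = \<psi> u + \<psi> v" if "u \<in> V_space n" "v \<in> V_space n" for u v
    unfolding \<psi>_def
    by (simp only: col_add[OF carr[OF that(1)] carr[OF that(2)] zero_less_Suc]
        mult_add_distrib_mat_vec[OF A colc[OF carr[OF that(1)]] colc[OF carr[OF that(2)]]])
  have \<psi>_smult: "\<psi> (c \<cdot>\<^sub>m v) = c \<cdot>\<^sub>v \<psi> v" if "v \<in> V_space n" for c v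
  proof -
    have "col (c \<cdot>\<^sub>m v) 0 = c \<cdot>\<^sub>v col v 0" using carr[OF that] by (intro col_smult) simp
    then show ?thesis
      unfolding \<psi>_def by (simp only: mult_mat_vec[OF A colc[OF carr[OF that]]])
  qed
  have linear: "linear_map class_ring (mat_vs ?N (V_space n)) (module_vec TYPE(complex) ?m) \<psi>"
  proof (rule linear_mapI[OF mat_vs_vectorspace[OF subsp] vec_vectorspace])
    show "\<psi> x \<in> carrier (module_vec TYPE(complex) ?m)" if "x \<in> carrier (mat_vs ?N (V_space n))" for x
      using \<psi>_carr[of x] that by (simp add: module_vec_simps)
    show "\<psi> (x \<oplus>\<^bsub>mat_vs ?N (V_space n)\<^esub> y) = \<psi> x \<oplus>\<^bsub>module_vec TYPE(complex) ?m\<^esub> \<psi> y"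
      if "x \<in> carrier (mat_vs ?N (V_space n))" "y \<in> carrier (mat_vs ?N (V_space n))" for x y
      using \<psi>_add[of x y] that by (simp add: module_mat_simps module_vec_simps)
    show "\<psi> (c \<odot>\<^bsub>mat_vs ?N (V_space n)\<^esub> x) = c \<odot>\<^bsub>module_vec TYPE(complex) ?m\<^esub> \<psi> x"
      if "x \<in> carrier (mat_vs ?N (V_space n))" for c x
      using \<psi>_smult[of x c] that by (simp add: module_mat_simps module_vec_simps)
  qed
  \<comment> \<open>As \<open>B A\<close> is the projection to the middle, \<open>B\<close> recovers
    the first column there, which determines \<open>v\<close>.\<close>
  have B\<psi>: "(B *\<^sub>v \<psi> v) $ i = v $$ (i, 0)" if "v \<in> V_space n" "0 < i" "i < 2 * n" for v i
  proof -
    have "B *\<^sub>v \<psi> v = middle_proj n *\<^sub>v col v 0"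
      unfolding \<psi>_def BA[symmetric] by (rule assoc_mult_mat_vec[OF B A colc[OF carr[OF that(1)]], symmetric])
    moreover have "\<dots> $ i = v $$ (i, 0)"
      using that carr[OF that(1)] by (subst index_mult_mat_vec_middle_proj[OF colc[OF carr[OF that(1)]]]) auto
    ultimately show ?thesis by (simp only:)
  qed
  have inj: "inj_on \<psi> (V_space n)"
  proof (rule inj_onI)
    fix u v assume uv: "u \<in> V_space n" "v \<in> V_space n" and eq: "\<psi> u = \<psi> v"
    let ?d = "u + (- 1) \<cdot>\<^sub>m v"
    have "?d \<in> V_space n" by (intro mat_subspaceD(3,4)[OF subsp] uv)
    moreover have "?d $$ (i, 0) = 0" if "0 < i" "i < 2 * n" for i
    proof -
      have "u $$ (i, 0) = v $$ (i, 0)"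
        using B\<psi>[OF uv(1) that] B\<psi>[OF uv(2) that] eq by simp
      then show ?thesis using that carr[OF uv(1)] carr[OF uv(2)] by simp
    qed
    ultimately have d0: "?d = 0\<^sub>m ?N ?N" by (rule V_space_zero[OF assms])
    show "u = v"
    proof (rule eq_matI)
      fix i j assume "i < dim_row v" "j < dim_col v"
      then have ij: "i < ?N" "j < ?N" using carr[OF uv(2)] by simp_all
      have "?d $$ (i, j) = 0" unfolding d0 using ij by simp
      then show "u $$ (i, j) = v $$ (i, j)" using ij carr[OF uv(1)] carr[OF uv(2)] by simp
    qed (use carr[OF uv(1)] carr[OF uv(2)] in simp_all)
  qed
  have surj: "\<exists>v\<in>V_space n. \<psi> v = w" if w: "w \<in> carrier_vec ?m" for w
  proof (rule bexI)
    \<comment> \<open>The preimage has first column \<open>B w\<close>. This vector has zero ends,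
      since \<open>B A\<close> fixes it by \<open>A B = 1\<close>.\<close>
    let ?v = "border_mat n (- 1) 0 (\<lambda>i. (B *\<^sub>v w) $ i)"
    show v: "?v \<in> V_space n" by (rule border_mat_V_space[OF assms])
    have Bw: "B *\<^sub>v w \<in> carrier_vec ?N" by (rule mult_mat_vec_carrier[OF B w])
    have ABw: "A *\<^sub>v (B *\<^sub>v w) = w"
      using w by (simp only: assoc_mult_mat_vec[OF A B w, symmetric] AB one_mult_mat_vec)
    have fixed: "B *\<^sub>v w = middle_proj n *\<^sub>v (B *\<^sub>v w)"
      unfolding BA[symmetric] assoc_mult_mat_vec[OF B A Bw] ABw ..
    have Bw_index: "(B *\<^sub>v w) $ i = (if 0 < i \<and> i < 2 * n then (B *\<^sub>v w) $ i else 0)" if "i < ?N" for i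
    proof -
      have "(B *\<^sub>v w) $ i = (middle_proj n *\<^sub>v (B *\<^sub>v w)) $ i" by (rule arg_cong[OF fixed])
      also note index_mult_mat_vec_middle_proj[OF Bw that]
      finally show ?thesis .
    qed
    have "col ?v 0 = B *\<^sub>v w"
    proof (rule eq_vecI)
      fix i assume "i < dim_vec (B *\<^sub>v w)"
      then have i: "i < ?N" using B by simp
      have "col ?v 0 $ i = (if 0 < i \<and> i < 2 * n then (B *\<^sub>v w) $ i else 0)"
        using i by (simp add: border_mat_def)
      then show "col ?v 0 $ i = (B *\<^sub>v w) $ i" unfolding Bw_index[OF i, symmetric] .
    qed (use B in \<open>simp add: border_mat_def\<close>)
    then show "\<psi> ?v = w" unfolding \<psi>_def by (simp only: ABw)
  qed
  have "\<psi> ` V_space n = carrier_vec ?m"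
    using \<psi>_carr surj by blast
  then have bij: "bij_betw \<psi> (V_space n) (carrier_vec ?m)" using inj by (simp only: bij_betw_def simp_thms)
  have equivariant: "\<psi> (lie_bracket X v) = (A * X * B) *\<^sub>v \<psi> v"
    if X: "X \<in> g0_tilde n" and v: "v \<in> V_space n" for X v
  proof -
    have Xc: "X \<in> carrier_mat ?N ?N" by (rule g0_tilde_carrier[OF X])
    note vc = carr[OF v]
    have XBA: "X * (B * A) = X"
      using X unfolding g0_tilde_eq_compression A_def B_def mem_Collect_eq by (rule conjunct2)
    have "col (lie_bracket X v) 0 = X *\<^sub>v col v 0"
    proof (rule eq_vecI)
      fix i assume "i < dim_vec (X *\<^sub>v col v 0)"
      then have i: "i < ?N" using Xc by simp
      have "(\<Sum>k = 0..<?N. v $$ (i, k) * X $$ (k, 0)) = 0"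
        by (rule sum.neutral) (use g0_tilde_entries[OF X] in auto)
      then have "(v * X) $$ (i, 0) = 0"
        using i Xc vc by (simp add: scalar_prod_def del: sum.op_ivl_Suc)
      moreover have "(X * v) $$ (i, 0) = (X *\<^sub>v col v 0) $ i"
        using i Xc vc by simp
      ultimately show "col (lie_bracket X v) 0 $ i = (X *\<^sub>v col v 0) $ i"
        using i Xc vc by (simp add: lie_bracket_def del: index_mult_mat(1) index_mult_mat_vec)
    qed (use Xc vc in \<open>simp add: lie_bracket_def\<close>)
    then have "\<psi> (lie_bracket X v) = A *\<^sub>v (X *\<^sub>v col v 0)" by (simp only: \<psi>_def)
    \<comment> \<open>Inserting \<open>B A\<close> after \<open>X\<close> splits the expression into
      the image of \<open>X\<close> and \<open>\<psi> v\<close>.\<close>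
    also have "\<dots> = A *\<^sub>v (X * (B * A) *\<^sub>v col v 0)" by (simp only: XBA)
    also have "\<dots> = (A * X * B) *\<^sub>v \<psi> v"
    proof -
      have AXB: "A * X * B \<in> carrier_mat ?m ?m" by (intro mult_carrier_mat[OF mult_carrier_mat[OF A Xc] B])
      have "(A * X * B) *\<^sub>v \<psi> v = (A * X * B * A) *\<^sub>v col v 0"
        unfolding \<psi>_def by (rule assoc_mult_mat_vec[OF AXB A colc[OF vc], symmetric])
      also have "A * X * B * A = A * (X * (B * A))"
        using A B Xc by (simp add: assoc_mult_mat_dim)
      also have "A * (X * (B * A)) *\<^sub>v col v 0 = A *\<^sub>v (X * (B * A) *\<^sub>v col v 0)"
        unfolding XBA by (rule assoc_mult_mat_vec[OF A Xc colc[OF vc]])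
      finally show ?thesis ..
    qed
    finally show ?thesis .
  qed
  have iso: "lie_isomorphism ?N (g0_tilde n) ?m (so_alg ?m) (\<lambda>X. A * X * B)"
    unfolding A_def B_def by (rule g0_tilde_lie_isomorphism)
  show ?thesis
    unfolding is_vector_representation_def
    by (intro conjI ballI exI[of _ "\<lambda>X. A * X * B"] exI[of _ \<psi>])
      (rule subsp lie_bracket_V_space[OF assms] iso linear bij equivariant; assumption)+
qed

theorem mainTheorem3:
  fixes n :: nat
  assumes "n \<ge> 2"
  shows
    "lie_isomorphic (2 * n + 1) (g_alg n) (2 * n + 1) (so_alg (2 * n + 1)) \<and>
     lie_isomorphism (2 * n + 1) (g_alg n) (2 * n + 1) (g_alg n) (theta n) \<and>
     (\<forall>Z\<in>g_alg n. theta n (theta n Z) = Z) \<and>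
     internal_direct_sum (2 * n + 1) (g_alg n) (g0 n) (g1 n) \<and>
     mat_lie_algebra (2 * n + 1) (g0_tilde n) \<and>
     internal_direct_sum (2 * n + 1) (g0 n) (g0_tilde n) (V_space n) \<and>
     lie_isomorphic (2 * n + 1) (g0_tilde n) (2 * n - 1) (so_alg (2 * n - 1)) \<and>
     lie_type_B (n - 1) (2 * n + 1) (g0_tilde n) \<and>
     is_vector_representation (2 * n - 1) (2 * n + 1) (g0_tilde n) (V_space n) \<and>
     lie_isomorphic (2 * n + 1) (g0 n) (2 * n) (so_alg (2 * n)) \<and>
     has_dim (2 * n + 1) (g0_tilde n) ((n - 1) * (2 * n - 1)) \<and>
     has_dim (2 * n + 1) (V_space n) (2 * n - 1) \<and>
     has_dim (2 * n + 1) (g1 n) (2 * n)"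
proof -
  \<comment> \<open>The last equation identifies the size in type \<open>B\<close> of rank
    \<open>n - 1\<close> with that of the middle block; with truncated subtraction it relies on
    \<open>n\<close> being positive.\<close>
  have n: "0 < n" and N: "2 * n + 1 = Suc (2 * n)" and B: "2 * (n - 1) + 1 = 2 * n - 1"
    using assms by simp_all
  have iso: "lie_isomorphic (Suc (2 * n)) (g0_tilde n) (2 * n - 1) (so_alg (2 * n - 1))"
    unfolding lie_isomorphic_def using g0_tilde_lie_isomorphism by blast
  have invol: "\<forall>Z\<in>g_alg n. theta n (theta n Z) = Z"
    unfolding g_alg_eq_so_rev N by (intro ballI theta_involution[OF n] so_rev_carrier)
  show ?thesis
    unfolding lie_type_B_def B N
    by (intro conjI)
      (rule g_alg_lie_isomorphic theta_lie_isomorphism[OF n, unfolded N] invol g_alg_direct_sum[OF n]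
        g0_tilde_lie_algebra g0_direct_sum[OF n] iso V_space_vector_representation[OF n]
        g0_lie_isomorphic[OF n] g0_tilde_dim[OF n] V_space_dim[OF n] g1_dim[OF n])+
qed

end
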